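(* The category $\mathsf{P}_{\mathbb{Z}}$ of rational polyhedra and $\mathbb{Z}$-maps is closed under finite limits, i.e. every finite diagram in $\mathsf{P}_{\mathbb{Z}}$ has a limit in $\mathsf{P}_{\mathbb{Z}}$.
   Context: A rational simplex in $\mathbb{R}^n$ is the convex hull of finitely many affinely independent points with rational coordinates. A rational polyhedron in $\mathbb{R}^n$ is a finite union of (closed) rational simplexes in $\mathbb{R}^n$ (the empty set is allowed). A triangulation of a rational polyhedron $P$ is a (finite) simplicial complex $\Delta$ consisting of rational simplexes whose union is $P$. For a rational polyhedron $P\subseteq\mathbb{R}^n$, a map $\eta\colon P\to\mathbb{R}^m$ is a $\mathbb{Z}$-map if there is a triangulation $\Delta$ of $P$ such that over every simplex $T\in\Delta$, $\eta$ coincides with an affine linear map $x\mapsto M_Tx+b_T$ with integer coefficients (integer matrix $M_T$, integer vector $b_T$). A $\mathbb{Z}$-map $\eta\colon P\to Q$ into a rational polyhedron $Q\subseteq\mathbb{R}^m$ is a $\mathbb{Z}$-map $P\to\mathbb{R}^m$ with $\eta(P)\subseteq Q$. $\mathsf{P}_{\mathbb{Z}}$ is the category whose objects are rational polyhedra in $\mathbb{R}^n$ for $n=1,2,\ldots$, and whose arrows are $\mathbb{Z}$-maps. *)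

theory Defs
  imports "HOL-Analysis.Analysis" "HOL-Analysis.Finite_Function_Topology"
begin

section \<open>Categories, functors and limits\<close>

record ('o, 'a) cat =
  Ob :: "'o set"
  Ar :: "'a set"
  src :: "'a \<Rightarrow> 'o"
  tgt :: "'a \<Rightarrow> 'o"
  idn :: "'o \<Rightarrow> 'a"
  cmp :: "'a \<Rightarrow> 'a \<Rightarrow> 'a"

text \<open>\<open>cmp C g f\<close> is \<open>g\<close> after \<open>f\<close>; it is only meaningful when \<open>tgt C f = src C g\<close>.\<close>

definition hom_set :: "('o, 'a) cat \<Rightarrow> 'o \<Rightarrow> 'o \<Rightarrow> 'a set" where
  "hom_set C X Y = {f \<in> Ar C. src C f = X \<and> tgt C f = Y}"

locale category =
  fixes C :: "('o, 'a) cat"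
  assumes src_Ob: "f \<in> Ar C \<Longrightarrow> src C f \<in> Ob C"
    and tgt_Ob: "f \<in> Ar C \<Longrightarrow> tgt C f \<in> Ob C"
    and idn_hom: "X \<in> Ob C \<Longrightarrow> idn C X \<in> hom_set C X X"
    and cmp_hom: "\<lbrakk>f \<in> hom_set C X Y; g \<in> hom_set C Y Z\<rbrakk> \<Longrightarrow> cmp C g f \<in> hom_set C X Z"
    and cmp_idn: "f \<in> hom_set C X Y \<Longrightarrow> cmp C f (idn C X) = f"
    and idn_cmp: "f \<in> hom_set C X Y \<Longrightarrow> cmp C (idn C Y) f = f"
    and cmp_assoc: "\<lbrakk>f \<in> hom_set C W X; g \<in> hom_set C X Y; h \<in> hom_set C Y Z\<rbrakk>
      \<Longrightarrow> cmp C h (cmp C g f) = cmp C (cmp C h g) f"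

definition finite_category :: "('o, 'a) cat \<Rightarrow> bool" where
  "finite_category C \<longleftrightarrow> category C \<and> finite (Ob C) \<and> finite (Ar C)"

definition is_functor ::
  "('j, 'f) cat \<Rightarrow> ('o, 'a) cat \<Rightarrow> ('j \<Rightarrow> 'o) \<Rightarrow> ('f \<Rightarrow> 'a) \<Rightarrow> bool" where
  "is_functor J C Fo Fa \<longleftrightarrow>
     (\<forall>j\<in>Ob J. Fo j \<in> Ob C) \<and>
     (\<forall>f\<in>Ar J. Fa f \<in> hom_set C (Fo (src J f)) (Fo (tgt J f))) \<and>
     (\<forall>j\<in>Ob J. Fa (idn J j) = idn C (Fo j)) \<and>
     (\<forall>f\<in>Ar J. \<forall>g\<in>Ar J. tgt J f = src J g \<longrightarrow> Fa (cmp J g f) = cmp C (Fa g) (Fa f))"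

definition is_cone ::
  "('j, 'f) cat \<Rightarrow> ('o, 'a) cat \<Rightarrow> ('j \<Rightarrow> 'o) \<Rightarrow> ('f \<Rightarrow> 'a) \<Rightarrow> 'o \<Rightarrow> ('j \<Rightarrow> 'a) \<Rightarrow> bool" where
  "is_cone J C Fo Fa X \<pi> \<longleftrightarrow>
     X \<in> Ob C \<and>
     (\<forall>j\<in>Ob J. \<pi> j \<in> hom_set C X (Fo j)) \<and>
     (\<forall>f\<in>Ar J. cmp C (Fa f) (\<pi> (src J f)) = \<pi> (tgt J f))"

definition is_limit ::
  "('j, 'f) cat \<Rightarrow> ('o, 'a) cat \<Rightarrow> ('j \<Rightarrow> 'o) \<Rightarrow> ('f \<Rightarrow> 'a) \<Rightarrow> 'o \<Rightarrow> ('j \<Rightarrow> 'a) \<Rightarrow> bool" where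
  "is_limit J C Fo Fa L \<pi> \<longleftrightarrow>
     is_cone J C Fo Fa L \<pi> \<and>
     (\<forall>Y \<mu>. is_cone J C Fo Fa Y \<mu> \<longrightarrow>
        (\<exists>!u. u \<in> hom_set C Y L \<and> (\<forall>j\<in>Ob J. cmp C (\<pi> j) u = \<mu> j)))"


section \<open>Rational polyhedra\<close>

text \<open>The dimension of the ambient space has to vary within the category, so \<open>\<real>\<^sup>n\<close> is
  realised as the subspace of the real vector space of finitely supported sequences in which
  only the coordinates \<open>0, \<dots>, n - 1\<close> may be nonzero.\<close>

type_synonym pt = "nat \<Rightarrow>\<^sub>0 real"

definition Rn :: "nat \<Rightarrow> pt set" where
  "Rn n = {x. Poly_Mapping.keys x \<subseteq> {..<n}}"

definition rational_simplex :: "nat \<Rightarrow> pt set \<Rightarrow> bool" where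
  "rational_simplex n S \<longleftrightarrow>
     (\<exists>V. finite V \<and> V \<subseteq> Rn n \<and> (\<forall>v\<in>V. \<forall>i. Poly_Mapping.lookup v i \<in> \<rat>) \<and>
          \<not> affine_dependent V \<and> S = convex hull V)"

definition rational_polyhedron :: "nat \<Rightarrow> pt set \<Rightarrow> bool" where
  "rational_polyhedron n P \<longleftrightarrow>
     (\<exists>\<F>. finite \<F> \<and> (\<forall>S\<in>\<F>. rational_simplex n S) \<and> P = \<Union>\<F>)"

text \<open>The complex conditions are those of the library's \<open>simplicial_complex\<close>, which is
  confined to \<open>euclidean_space\<close> types. As there, the empty set counts as a (rational)
  simplex and as a face of every simplex.\<close>

definition rational_triangulation :: "nat \<Rightarrow> pt set set \<Rightarrow> pt set \<Rightarrow> bool" where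
  "rational_triangulation n \<Delta> P \<longleftrightarrow>
     finite \<Delta> \<and>
     (\<forall>S\<in>\<Delta>. rational_simplex n S) \<and>
     (\<forall>F S. S \<in> \<Delta> \<and> F face_of S \<longrightarrow> F \<in> \<Delta>) \<and>
     (\<forall>S S'. S \<in> \<Delta> \<and> S' \<in> \<Delta> \<longrightarrow> (S \<inter> S') face_of S) \<and>
     \<Union>\<Delta> = P"


section \<open>The category of rational polyhedra and integer maps\<close>

text \<open>\<open>M i j\<close> for \<open>i < m\<close>, \<open>j < n\<close> are the entries of an integer \<open>m \<times> n\<close> matrix and \<open>b i\<close>
  for \<open>i < m\<close> those of an integer vector; other values are irrelevant.\<close>

definition Z_map :: "nat \<Rightarrow> pt set \<Rightarrow> nat \<Rightarrow> (pt \<Rightarrow> pt) \<Rightarrow> bool" where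
  "Z_map n P m \<eta> \<longleftrightarrow>
     \<eta> \<in> P \<rightarrow> Rn m \<and>
     (\<exists>\<Delta>. rational_triangulation n \<Delta> P \<and>
       (\<forall>T\<in>\<Delta>. \<exists>(M :: nat \<Rightarrow> nat \<Rightarrow> int) (b :: nat \<Rightarrow> int). \<forall>x\<in>T. \<forall>i<m.
          Poly_Mapping.lookup (\<eta> x) i =
            (\<Sum>j<n. of_int (M i j) * Poly_Mapping.lookup x j) + of_int (b i)))"

text \<open>An object \<open>(n, P)\<close> is a polyhedron \<open>P\<close> together with its ambient space \<open>\<real>\<^sup>n\<close>, \<open>n \<ge> 1\<close>.
  An arrow carries its domain and codomain, and its underlying function is extensional
  (\<open>undefined\<close> off the domain), so that equality of arrows is equality of maps \<open>P \<rightarrow> Q\<close>.\<close>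

type_synonym pobj = "nat \<times> pt set"
type_synonym parr = "pobj \<times> (pt \<Rightarrow> pt) \<times> pobj"

definition PZ_objects :: "pobj set" where
  "PZ_objects = {(n, P). n \<ge> 1 \<and> rational_polyhedron n P}"

definition PZ_arrows :: "parr set" where
  "PZ_arrows = {((n, P), \<eta>, (m, Q)) | n P \<eta> m Q.
     (n, P) \<in> PZ_objects \<and> (m, Q) \<in> PZ_objects \<and>
     \<eta> \<in> extensional P \<and> Z_map n P m \<eta> \<and> \<eta> ` P \<subseteq> Q}"

definition PZ :: "(pobj, parr) cat" where
  "PZ = \<lparr> Ob = PZ_objects,
          Ar = PZ_arrows,
          src = (\<lambda>(A, \<eta>, B). A),
          tgt = (\<lambda>(A, \<eta>, B). B),
          idn = (\<lambda>A. (A, restrict (\<lambda>x. x) (snd A), A)),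
          cmp = (\<lambda>(B', \<theta>, C) (A, \<eta>, B). (A, compose (snd A) \<theta> \<eta>, C)) \<rparr>"

end

theory Submission
  imports Defs
begin

text \<open>
  The idea is to trade triangulations for coarser covers. Call a subset of \<open>\<real>\<^sup>n\<close> an \<open>h_polyhedron\<close> if
  finitely many affine inequalities with rational coefficients cut it out. Such sets are visibly closed
  under intersections, preimages along rational affine maps and equations between rational affine
  functions, which is not apparent for unions of simplexes. Two facts connect them with the definitions.

  A rational simplex is cut out by rational inequalities (\<open>rational_hull_h_polyhedron\<close>): adding one
  vertex to a convex hull amounts to projecting along one real parameter, and Fourier--Motzkin
  elimination of the parameter stays within rational inequalities.

  Conversely, if a finite union of \<open>h_polyhedron\<close>s is bounded, it has a rational triangulation each
  of whose simplexes lies in one of them (\<open>rational_triangulation_of_cover\<close>). The inequalities that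
  occur define a hyperplane arrangement, whose open cells are the classes of points with equal signs.
  A rational centre is chosen in every cell, and the simplexes of the barycentric subdivision are the
  convex hulls of chains of centres. Rational centres exist because a real solution of
  rational equations can be approximated by rational solutions.

  Hence rational polyhedra are the bounded finite unions of \<open>h_polyhedron\<close>s
  (\<open>rational_polyhedron_iff\<close>), and a map is a \<open>\<int>\<close>-map if and only if each of its coordinates is an
  integral affine function on every member of some finite cover by \<open>h_polyhedron\<close>s (\<open>Z_map_iff\<close>). With this
  description composites of \<open>\<int>\<close>-maps are \<open>\<int>\<close>-maps. The limit of a finite diagram is the usual set of
  compatible families, placed in a large \<open>\<real>\<^sup>N\<close> with one block of coordinates for each object of the
  diagram; the block projections and the gluing of blocks only copy coordinates, so they are integral,
  and compatibility is an equation between piecewise integral affine functions.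
\<close>

section \<open>Simplexes and their faces\<close>

text \<open>In a vanishing linear combination over \<open>insert a S\<close> with coefficient sum 0 and \<open>u a \<noteq> 0\<close> one can solve for \<open>a\<close>, which puts \<open>a\<close>
  into \<open>affine hull S\<close>. The argument is valid in any real vector space, in particular in the infinite
  dimensional space of finitely supported sequences.\<close>

lemma affine_independent_insert_outside:
  assumes S: "\<not> affine_dependent S" and a: "a \<notin> affine hull S"
  shows "\<not> affine_dependent (insert a S)"
proof
  assume "affine_dependent (insert a S)"
  then obtain T u v where T: "finite T" "T \<subseteq> insert a S" "sum u T = 0" "v \<in> T" "u v \<noteq> 0"
      "(\<Sum>w\<in>T. u w *\<^sub>R w) = 0"
    by (auto simp: affine_dependent_explicit)
  show False
  proof (cases "a \<in> T \<and> u a \<noteq> 0")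
    case False
    have T': "T - {a} \<subseteq> S" "finite (T - {a})" using T by auto
    have "sum u (T - {a}) = 0" "(\<Sum>w\<in>T - {a}. u w *\<^sub>R w) = 0"
      using T False by (auto simp: sum_diff1)
    moreover have "v \<in> T - {a}" using T False by auto
    ultimately show False
      using S T' T(5) unfolding affine_dependent_explicit by blast
  next
    case True
    have T': "T - {a} \<subseteq> S" "finite (T - {a})" using T by auto
    define c where "c w = - u w / u a" for w
    have s1: "sum u (T - {a}) = - u a" "(\<Sum>w\<in>T - {a}. u w *\<^sub>R w) = - (u a *\<^sub>R a)"
      using T True by (auto simp: sum_diff1)
    have "sum c (T - {a}) = - sum u (T - {a}) / u a"
      by (simp add: c_def sum_divide_distrib sum_negf)
    then have 1: "sum c (T - {a}) = 1" using s1 True by simp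
    have "(\<Sum>w\<in>T - {a}. c w *\<^sub>R w) = (- inverse (u a)) *\<^sub>R (\<Sum>w\<in>T - {a}. u w *\<^sub>R w)"
      unfolding scaleR_right.sum by (simp add: c_def divide_inverse mult.commute)
    then have 2: "(\<Sum>w\<in>T - {a}. c w *\<^sub>R w) = a" using s1 True by simp
    have "T - {a} \<noteq> {}" using 1 by (metis sum.empty zero_neq_one)
    with 1 2 T' have "a \<in> affine hull S" unfolding affine_hull_explicit by blast
    with a show False ..
  qed
qed

text \<open>The difference of two representations of a common point would be a nontrivial affine dependence of \<open>V\<close>.\<close>

lemma affine_independent_disjoint_hulls:
  assumes V: "finite V" "\<not> affine_dependent V" and W: "W \<subseteq> V"
  shows "affine hull W \<inter> convex hull (V - W) = {}"
proof (rule ccontr)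
  assume "affine hull W \<inter> convex hull (V - W) \<noteq> {}"
  then obtain x where x: "x \<in> affine hull W" "x \<in> convex hull (V - W)" by blast
  have fin: "finite W" "finite (V - W)" using V W finite_subset by auto
  obtain a where a: "sum a W = 1" "(\<Sum>v\<in>W. a v *\<^sub>R v) = x"
    using x(1) fin by (auto simp: affine_hull_finite)
  obtain b where b: "sum b (V - W) = 1" "(\<Sum>v\<in>V - W. b v *\<^sub>R v) = x"
    using x(2) fin by (auto simp: convex_hull_finite)
  define c where "c v = (if v \<in> W then a v else - b v)" for v
  have "sum c V = sum c (V - W) + sum c W"
    by (rule sum.subset_diff[OF W V(1)])
  also have "sum c (V - W) = - sum b (V - W)"
    by (simp add: c_def sum_negf[symmetric])
  also have "sum c W = sum a W" by (simp add: c_def)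
  finally have 1: "sum c V = 0" using a b by simp
  have "(\<Sum>v\<in>V. c v *\<^sub>R v) = (\<Sum>v\<in>V - W. c v *\<^sub>R v) + (\<Sum>v\<in>W. c v *\<^sub>R v)"
    by (rule sum.subset_diff[OF W V(1)])
  also have "(\<Sum>v\<in>V - W. c v *\<^sub>R v) = - (\<Sum>v\<in>V - W. b v *\<^sub>R v)"
    by (simp add: c_def sum_negf[symmetric])
  also have "(\<Sum>v\<in>W. c v *\<^sub>R v) = (\<Sum>v\<in>W. a v *\<^sub>R v)" by (simp add: c_def)
  finally have 2: "(\<Sum>v\<in>V. c v *\<^sub>R v) = 0" using a b by simp
  have "\<exists>v\<in>W. a v \<noteq> 0" using a(1) by (metis sum.neutral zero_neq_one)
  then have "\<exists>v\<in>V. c v \<noteq> 0" using W by (auto simp: c_def)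
  with 1 2 V show False by (auto simp: affine_dependent_explicit_finite)
qed

lemma convex_hull_subset_face_of:
  assumes "finite V" "\<not> affine_dependent V" "W \<subseteq> V"
  shows "(convex hull W) face_of (convex hull V)"
  by (rule face_of_convex_hulls[OF assms(1,3) affine_independent_disjoint_hulls[OF assms]])

text \<open>A face is spanned by the vertices that it contains, because a vertex with positive weight in a
  point of the face is the end point of a segment in the hull through that point.\<close>

lemma face_of_convex_hull_eq_hull:
  assumes V: "finite V" and F: "F face_of (convex hull V)"
  shows "F = convex hull (F \<inter> V)"
proof
  show "convex hull (F \<inter> V) \<subseteq> F"
    using F by (simp add: face_of_def hull_minimal)
  show "F \<subseteq> convex hull (F \<inter> V)"
  proof
    fix x assume x: "x \<in> F"
    then obtain u where u: "\<And>v. v \<in> V \<Longrightarrow> 0 \<le> u v" "sum u V = 1" "(\<Sum>v\<in>V. u v *\<^sub>R v) = x"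
      using F V by (force simp: face_of_def convex_hull_finite)
    \<comment> \<open>a vertex of positive weight is \<open>x\<close> itself or an endpoint of a segment through \<open>x\<close>\<close>
    have inF: "v \<in> F" if v: "v \<in> V" "u v > 0" for v
    proof (cases "v = x")
      case False
      have s: "sum u (V - {v}) = 1 - u v" "(\<Sum>w\<in>V - {v}. u w *\<^sub>R w) = x - u v *\<^sub>R v"
        using u V v by (auto simp: sum_diff1)
      have "sum u (V - {v}) \<ge> 0" using u by (auto intro: sum_nonneg)
      moreover have "u v \<noteq> 1"
      proof
        assume "u v = 1"
        then have "sum u (V - {v}) = 0" using s by simp
        then have "\<forall>w\<in>V - {v}. u w = 0" using u V by (subst (asm) sum_nonneg_eq_0_iff) auto
        then have "(\<Sum>w\<in>V - {v}. u w *\<^sub>R w) = 0" by simp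
        with s \<open>u v = 1\<close> False show False by simp
      qed
      ultimately have lt: "u v < 1" using s by simp
      define y where "y = (1 / (1 - u v)) *\<^sub>R (x - u v *\<^sub>R v)"
      have "y = (\<Sum>w\<in>V - {v}. (u w / (1 - u v)) *\<^sub>R w)"
        unfolding y_def s(2)[symmetric] scaleR_right.sum by (simp add: mult.commute)
      moreover have "(\<Sum>w\<in>V - {v}. u w / (1 - u v)) = 1"
        using s lt by (simp add: sum_divide_distrib[symmetric])
      ultimately have "y \<in> convex hull (V - {v})"
        using V u lt by (auto simp: convex_hull_finite intro!: exI[of _ "\<lambda>w. u w / (1 - u v)"])
      then have y: "y \<in> convex hull V" by (meson Diff_subset hull_mono subsetD)
      have xe: "x = (1 - u v) *\<^sub>R y + u v *\<^sub>R v" using lt by (simp add: y_def)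
      have "y \<noteq> v"
      proof
        assume "y = v"
        then have "x = v" using xe by (simp add: algebra_simps)
        with False show False by simp
      qed
      then have "x \<in> open_segment y v" using xe v lt by (auto simp: in_segment)
      then show ?thesis using F x y hull_inc[OF v(1), of convex] unfolding face_of_def by blast
    qed (use x in simp)
    have "sum u (F \<inter> V) = 1" "(\<Sum>v\<in>F \<inter> V. u v *\<^sub>R v) = x"
    proof -
      have z: "\<forall>v\<in>V - F \<inter> V. u v = 0" using inF u by (metis DiffE IntI less_eq_real_def)
      show "sum u (F \<inter> V) = 1"
        using sum.mono_neutral_left[of V "F \<inter> V" u] z V u by auto
      show "(\<Sum>v\<in>F \<inter> V. u v *\<^sub>R v) = x"
        using sum.mono_neutral_left[of V "F \<inter> V" "\<lambda>v. u v *\<^sub>R v"] z V u by auto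
    qed
    then show "x \<in> convex hull (F \<inter> V)"
      using V u by (auto simp: convex_hull_finite intro!: exI[of _ u])
  qed
qed

section \<open>Barycentric subdivision of a hyperplane arrangement\<close>

definition affine_fun :: "('a::real_vector \<Rightarrow> real) \<Rightarrow> bool" where
  "affine_fun g \<longleftrightarrow> (\<forall>x y u v. u + v = 1 \<longrightarrow> g (u *\<^sub>R x + v *\<^sub>R y) = u * g x + v * g y)"

lemma affine_funD:
  assumes "affine_fun g" "u + v = 1"
  shows "g (u *\<^sub>R x + v *\<^sub>R y) = u * g x + v * g y"
  using assms unfolding affine_fun_def by blast

definition same_signs :: "('a \<Rightarrow> real) set \<Rightarrow> 'a \<Rightarrow> 'a \<Rightarrow> bool" where
  "same_signs G x y \<longleftrightarrow> (\<forall>g\<in>G. sgn (g x) = sgn (g y))"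

text \<open>The face order on the sign vectors of an arrangement \<open>G\<close>: the point \<open>x\<close> satisfies the conditions that
  define the cell of \<open>y\<close>, with strict inequalities relaxed to weak ones.\<close>

definition below :: "('a \<Rightarrow> real) set \<Rightarrow> 'a \<Rightarrow> 'a \<Rightarrow> bool" where
  "below G x y \<longleftrightarrow> (\<forall>g\<in>G. g x = 0 \<or> sgn (g x) = sgn (g y))"

lemma same_signs_sym: "same_signs G x y \<Longrightarrow> same_signs G y x" by (simp add: same_signs_def)
lemma same_signs_imp_below: "same_signs G x y \<Longrightarrow> below G x y"
  by (simp add: same_signs_def below_def)
lemma below_trans: "below G x y \<Longrightarrow> below G y z \<Longrightarrow> below G x z"
  unfolding below_def by (metis sgn_0_0)

lemma below_alt:
  "below G x y \<longleftrightarrow> (\<forall>g\<in>G. (g y = 0 \<longrightarrow> g x = 0) \<and> (g y > 0 \<longrightarrow> g x \<ge> 0) \<and> (g y < 0 \<longrightarrow> g x \<le> 0))"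
proof -
  have "(r = 0 \<or> sgn r = sgn s) \<longleftrightarrow> (s = 0 \<longrightarrow> r = 0) \<and> (s > 0 \<longrightarrow> r \<ge> 0) \<and> (s < 0 \<longrightarrow> r \<le> 0)" for r s :: real
    by (cases r "0::real" rule: linorder_cases; cases s "0::real" rule: linorder_cases) auto
  then show ?thesis unfolding below_def by simp
qed

definition support :: "('a \<Rightarrow> real) set \<Rightarrow> 'a \<Rightarrow> ('a \<Rightarrow> real) set" where
  "support G x = {g \<in> G. g x \<noteq> 0}"

lemma strictly_below_support:
  assumes "below G x y" "\<not> same_signs G x y"
  shows "support G x \<subset> support G y"
proof
  show "support G x \<subseteq> support G y"
    using assms(1) by (force simp: below_alt support_def)
  obtain g where g: "g \<in> G" "sgn (g x) \<noteq> sgn (g y)"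
    using assms(2) unfolding same_signs_def by blast
  then have "g x = 0" using assms(1) unfolding below_def by blast
  moreover have "g y \<noteq> 0" using g calculation by auto
  ultimately show "support G x \<noteq> support G y" using g by (auto simp: support_def)
qed

text \<open>\<open>P\<close> is a union of closed cells of the arrangement \<open>G\<close> within the affine space \<open>X\<close>, and \<open>b\<close> picks a
  centre in every open cell. The assumption \<open>bounded_cells\<close> is the form in which boundedness of the
  cells is used: on a ray that starts in \<open>y\<close> and passes through another point \<open>x\<close> of the same open
  cell, some positive function of \<open>G\<close> decreases, and therefore the ray leaves the cell.\<close>

locale cell_complex =
  fixes G :: "('a::real_vector \<Rightarrow> real) set" and X P :: "'a set" and b :: "'a \<Rightarrow> 'a"
  assumes finite_G: "finite G"
    and affine_G: "g \<in> G \<Longrightarrow> affine_fun g"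
    and affine_X: "affine X"
    and P_subset: "P \<subseteq> X"
    and P_closed: "\<lbrakk>x \<in> P; y \<in> X; below G y x\<rbrakk> \<Longrightarrow> y \<in> P"
    and bounded_cells: "\<lbrakk>x \<in> P; y \<in> P; same_signs G x y; x \<noteq> y\<rbrakk> \<Longrightarrow> \<exists>g\<in>G. 0 < g x \<and> g x < g y"
    and centre_in_P: "x \<in> P \<Longrightarrow> b x \<in> P"
    and centre_signs: "x \<in> P \<Longrightarrow> same_signs G (b x) x"
    and centre_cong: "\<lbrakk>x \<in> P; y \<in> P; same_signs G x y\<rbrakk> \<Longrightarrow> b x = b y"
begin

lemma finite_support: "finite (support G x)" using finite_G by (simp add: support_def)

lemma card_support_less:
  "\<lbrakk>below G x y; \<not> same_signs G x y\<rbrakk> \<Longrightarrow> card (support G x) < card (support G y)"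
  by (intro psubset_card_mono finite_support strictly_below_support)

lemma centre_idem: "p \<in> b ` P \<Longrightarrow> b p = p"
  by (metis centre_in_P centre_cong centre_signs imageE)

text \<open>A centre is determined by its sign vector, and there are finitely many of those.\<close>

lemma finite_centres: "finite (b ` P)"
proof -
  have "inj_on (\<lambda>p. restrict (\<lambda>g. sgn (g p)) G) (b ` P)"
  proof (rule inj_onI)
    fix p q assume pq: "p \<in> b ` P" "q \<in> b ` P"
      and e: "restrict (\<lambda>g. sgn (g p)) G = restrict (\<lambda>g. sgn (g q)) G"
    then have "same_signs G p q" unfolding same_signs_def by (metis restrict_apply')
    then show "p = q" using pq centre_idem centre_in_P centre_cong by (metis imageE)
  qed
  moreover have "sgn r \<in> {-1, 0, 1}" for r :: real by (simp add: sgn_if)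
  then have "(\<lambda>p. restrict (\<lambda>g. sgn (g p)) G) ` (b ` P) \<subseteq> G \<rightarrow>\<^sub>E {-1, 0, 1}"
    by (intro image_subsetI restrict_PiE_iff[THEN iffD2] ballI)
  moreover have "finite (G \<rightarrow>\<^sub>E {-1, 0, 1::real})" using finite_G by (auto intro: finite_PiE)
  ultimately show ?thesis by (rule inj_on_finite)
qed

lemma convex_below: "convex {x. below G x y}"
proof -
  have "below G (u *\<^sub>R x + v *\<^sub>R z) y"
    if "below G x y" "below G z y" "u \<ge> 0" "v \<ge> 0" "u + v = 1" for x z u v
    unfolding below_alt
  proof (intro ballI conjI impI)
    fix g assume g: "g \<in> G"
    note e = affine_funD[OF affine_G[OF g] that(5), of x z]
    have x: "(g y = 0 \<longrightarrow> g x = 0) \<and> (g y > 0 \<longrightarrow> g x \<ge> 0) \<and> (g y < 0 \<longrightarrow> g x \<le> 0)"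
      "(g y = 0 \<longrightarrow> g z = 0) \<and> (g y > 0 \<longrightarrow> g z \<ge> 0) \<and> (g y < 0 \<longrightarrow> g z \<le> 0)"
      using that g by (auto simp: below_alt)
    show "g (u *\<^sub>R x + v *\<^sub>R z) = 0" if "g y = 0" using e x that by simp
    show "g (u *\<^sub>R x + v *\<^sub>R z) \<ge> 0" if "g y > 0" using e x that \<open>u \<ge> 0\<close> \<open>v \<ge> 0\<close> by simp
    show "g (u *\<^sub>R x + v *\<^sub>R z) \<le> 0" if "g y < 0"
      using e x that \<open>u \<ge> 0\<close> \<open>v \<ge> 0\<close> by (simp add: add_nonpos_nonpos mult_nonneg_nonpos)
  qed
  then show ?thesis by (auto simp: convex_def)
qed

text \<open>The open segment from a point \<open>y\<close> to a point in the closure of its cell remains in the open cell of \<open>y\<close>.\<close>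

lemma same_signs_combination:
  assumes "below G x y" "u > 0" "v \<ge> 0" "u + v = 1"
  shows "same_signs G (u *\<^sub>R y + v *\<^sub>R x) y"
  unfolding same_signs_def
proof
  fix g assume g: "g \<in> G"
  note e = affine_funD[OF affine_G[OF g] assms(4), of y x]
  have x: "(g y = 0 \<longrightarrow> g x = 0) \<and> (g y > 0 \<longrightarrow> g x \<ge> 0) \<and> (g y < 0 \<longrightarrow> g x \<le> 0)"
    using assms(1) g by (auto simp: below_alt)
  consider "g y = 0" | "g y > 0" | "g y < 0" by linarith
  then show "sgn (g (u *\<^sub>R y + v *\<^sub>R x)) = sgn (g y)"
  proof cases
    case 1 then show ?thesis using e x by simp
  next
    case 2
    then have "u * g y + v * g x > 0" using x assms by (simp add: add_pos_nonneg)
    then show ?thesis using e 2 by simp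
  next
    case 3
    then have "u * g y + v * g x < 0" using x assms
      by (simp add: add_neg_nonpos mult_pos_neg mult_nonneg_nonpos)
    then show ?thesis using e 3 by simp
  qed
qed

text \<open>The vertex sets of the barycentric subdivision: flags of cells, represented by their centres.\<close>

definition is_chain :: "'a set \<Rightarrow> bool" where
  "is_chain C \<longleftrightarrow> C \<subseteq> b ` P \<and> (\<forall>p\<in>C. \<forall>q\<in>C. below G p q \<or> below G q p)"

lemma chain_subset: "is_chain C \<Longrightarrow> D \<subseteq> C \<Longrightarrow> is_chain D"
  unfolding is_chain_def by blast

lemma chain_in_P: "is_chain C \<Longrightarrow> p \<in> C \<Longrightarrow> p \<in> P"
  unfolding is_chain_def using centre_in_P by auto

lemma chain_finite: "is_chain C \<Longrightarrow> finite C"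
  unfolding is_chain_def using finite_centres finite_subset by blast

lemma centres_same_signs: "p \<in> b ` P \<Longrightarrow> q \<in> b ` P \<Longrightarrow> same_signs G p q \<Longrightarrow> p = q"
  using centre_idem centre_in_P centre_cong by (metis imageE)

lemma chain_top:
  assumes "is_chain C" "C \<noteq> {}"
  obtains m where "m \<in> C" "\<forall>p\<in>C. below G p m"
proof -
  obtain m where m: "m \<in> C" "\<And>p. p \<in> C \<Longrightarrow> card (support G p) \<le> card (support G m)"
  proof -
    have "finite ((\<lambda>p. card (support G p)) ` C)" "(\<lambda>p. card (support G p)) ` C \<noteq> {}"
      using assms chain_finite by auto
    from Max_in[OF this] Max_ge[OF this(1)] show ?thesis using that by fastforce
  qed
  have "below G p m" if p: "p \<in> C" for p
  proof (rule ccontr)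
    assume n: "\<not> below G p m"
    then have "below G m p" using assms p m by (auto simp: is_chain_def)
    moreover have "\<not> same_signs G m p" using n same_signs_imp_below[of G p m] same_signs_sym[of G m p] by blast
    ultimately have "card (support G m) < card (support G p)"
      by (rule card_support_less)
    with m(2)[OF p] show False by simp
  qed
  with m(1) show ?thesis using that by blast
qed

lemma chain_induct [consumes 1, case_names empty insert]:
  assumes "is_chain C"
    and "Q {}"
    and "\<And>m D. \<lbrakk>is_chain (insert m D); is_chain D; m \<notin> D; \<forall>p\<in>D. below G p m; Q D\<rbrakk>
      \<Longrightarrow> Q (insert m D)"
  shows "Q C"
proof -
  from assms(1) show ?thesis
  proof (induction "card C" arbitrary: C)
    case 0
    then show ?case using chain_finite assms(2) by auto
  next
    case (Suc k)
    then have ne: "C \<noteq> {}" by auto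
    obtain m where m: "m \<in> C" "\<forall>p\<in>C. below G p m" using chain_top[OF Suc.prems ne] by blast
    have ch: "is_chain (C - {m})" using Suc.prems chain_subset by blast
    have "card (C - {m}) = k" using Suc m chain_finite by simp
    then have "Q (C - {m})" using Suc ch by blast
    then have "Q (insert m (C - {m}))"
      using assms(3)[of m "C - {m}"] m ch Suc.prems by (simp add: insert_absorb)
    then show ?case using m by (simp add: insert_absorb)
  qed
qed

lemma chain_hull_below:
  assumes "\<forall>p\<in>D. below G p m" "y \<in> convex hull D"
  shows "below G y m"
  using hull_minimal[of D "{x. below G x m}" convex] convex_below[of m] assms by blast

lemma chain_hull_subset_P:
  assumes "is_chain C"
  shows "convex hull C \<subseteq> P"
proof (cases "C = {}")
  case False
  then obtain m where m: "m \<in> C" "\<forall>p\<in>C. below G p m" using chain_top[OF assms] by blast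
  have "C \<subseteq> X" using P_subset chain_in_P[OF assms] by blast
  then have "convex hull C \<subseteq> X" by (intro hull_minimal affine_imp_convex[OF affine_X])
  then show ?thesis using P_closed[OF chain_in_P[OF assms m(1)]] chain_hull_below[OF m(2)] by blast
qed simp

text \<open>Some function of \<open>G\<close> vanishes on all smaller members of a chain but not at the largest, hence the
  largest is outside the affine hull of the others.\<close>

lemma chain_affine_independent:
  assumes "is_chain C"
  shows "\<not> affine_dependent C"
  using assms
proof (induction rule: chain_induct)
  case (insert m D)
  have "m \<notin> affine hull D"
  proof (cases "D = {}")
    case False
    then obtain d where d: "d \<in> D" "\<forall>p\<in>D. below G p d" using chain_top[OF insert(2)] by blast
    have "\<not> same_signs G d m"
      using centres_same_signs[of d m] insert(1,3) d(1) unfolding is_chain_def by blast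
    then have "support G d \<subset> support G m" using strictly_below_support[of G d m] insert(4) d(1) by blast
    then obtain g where g: "g \<in> G" "g m \<noteq> 0" "g d = 0" unfolding support_def by blast
    have "affine {x. g x = 0}"
      using affine_funD[OF affine_G[OF g(1)]] by (simp add: affine_def)
    moreover have "D \<subseteq> {x. g x = 0}" using d g by (auto simp: below_alt)
    ultimately have "affine hull D \<subseteq> {x. g x = 0}" by (simp add: hull_minimal)
    then show ?thesis using g by blast
  qed simp
  then show ?case by (rule affine_independent_insert_outside[OF insert(5)])
qed simp

text \<open>The largest centre with positive weight in \<open>z\<close> is the centre of the cell of \<open>z\<close>; the rest of the
  combination is a point in the hull of strictly smaller centres. So a point determines the top
  vertex of the simplex that carries it.\<close>

lemma chain_hull_cell:
  assumes "is_chain C" "z \<in> convex hull C"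
  shows "b z \<in> C \<and> (z = b z \<or> (\<exists>y \<in> convex hull (C \<inter> {p. below G p (b z) \<and> p \<noteq> b z}).
            \<exists>u v. u > 0 \<and> v > 0 \<and> u + v = 1 \<and> z = u *\<^sub>R b z + v *\<^sub>R y))"
  using assms
proof (induction arbitrary: z rule: chain_induct)
  case (insert m D)
  have mP: "m \<in> P" "b m = m" using chain_in_P[OF insert(1)] centre_idem[of m] insert(1) by (auto simp: is_chain_def)
  show ?case
  proof (cases "D = {}")
    case True
    then show ?thesis using insert mP by simp
  next
    case False
    obtain u v d where uvd: "u \<ge> 0" "v \<ge> 0" "u + v = 1" "d \<in> convex hull D" "z = u *\<^sub>R m + v *\<^sub>R d"
      using insert.prems by (auto simp: convex_hull_insert[OF False])
    consider "u = 0" | "v = 0" | "u > 0 \<and> v > 0" using uvd(1,2) by linarith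
    then show ?thesis
    proof cases
      case 1
      then have zD: "z \<in> convex hull D" using uvd by simp
      have "convex hull (D \<inter> {p. below G p (b z) \<and> p \<noteq> b z})
         \<subseteq> convex hull (insert m D \<inter> {p. below G p (b z) \<and> p \<noteq> b z})"
        by (rule hull_mono) auto
      then show ?thesis using insert.IH[OF zD] by blast
    next
      case 2
      then have "z = m" using uvd(3,5) by simp
      then show ?thesis using mP by simp
    next
      case 3
      have "below G d m" by (rule chain_hull_below[OF insert(4) uvd(4)])
      then have s: "same_signs G z m" unfolding uvd(5) using same_signs_combination[of d m u v] 3 uvd by auto
      have zP: "z \<in> P" using chain_hull_subset_P[OF insert(1)] insert.prems by blast
      have bz: "b z = m" using centre_cong[OF zP mP(1) s] mP by simp
      have "D \<subseteq> insert m D \<inter> {p. below G p m \<and> p \<noteq> m}" using insert by auto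
      then have "d \<in> convex hull (insert m D \<inter> {p. below G p m \<and> p \<noteq> m})"
        using uvd(4) hull_mono[of D _ convex] by blast
      then show ?thesis using bz 3 uvd by blast
    qed
  qed
qed simp

text \<open>A ray from the centre \<open>m\<close> meets the boundary of the cell of \<open>m\<close> at most once.\<close>

lemma exit_unique:
  assumes m: "m \<in> P" and y: "y1 \<in> P" "y2 \<in> P"
    and bel: "below G y1 m" "\<not> same_signs G y1 m" "below G y2 m" "\<not> same_signs G y2 m"
    and uv: "u1 > 0" "v1 > 0" "u1 + v1 = 1" "u2 > 0" "v2 > 0" "u2 + v2 = 1"
    and e: "u1 *\<^sub>R m + v1 *\<^sub>R y1 = u2 *\<^sub>R m + v2 *\<^sub>R y2"
  shows "y1 = y2"
proof -
  \<comment> \<open>if the exit parameters differ, one exit point is inside the segment from \<open>m\<close> to the other\<close>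
  have aux: False if h: "below G y2 m" "\<not> same_signs G y1 m" "u1 > 0" "v1 > 0" "u1 + v1 = 1" "u2 > 0" "v2 > 0" "u2 + v2 = 1"
     "u1 *\<^sub>R m + v1 *\<^sub>R y1 = u2 *\<^sub>R m + v2 *\<^sub>R y2" "v2 < v1" for y1 y2 u1 v1 u2 v2
  proof -
    have "v1 *\<^sub>R y1 = (u2 - u1) *\<^sub>R m + v2 *\<^sub>R y2"
      using h(9) by (simp add: algebra_simps)
    then have "(1 / v1) *\<^sub>R (v1 *\<^sub>R y1) = (1 / v1) *\<^sub>R ((u2 - u1) *\<^sub>R m + v2 *\<^sub>R y2)" by simp
    then have y1: "y1 = ((u2 - u1) / v1) *\<^sub>R m + (v2 / v1) *\<^sub>R y2"
      using h by (simp add: scaleR_right_distrib)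
    have "(u2 - u1) + v2 = v1" using h by simp
    then have "(u2 - u1) / v1 + v2 / v1 = 1"
      using h by (metis add_divide_distrib div_self less_irrefl)
    moreover have "(u2 - u1) / v1 > 0" using h by simp
    moreover have "v2 / v1 \<ge> 0" using h by simp
    ultimately have "same_signs G y1 m" unfolding y1 by (intro same_signs_combination[OF h(1)])
    with h show False by simp
  qed
  have "v1 = v2"
    using aux[OF bel(3) bel(2) uv e] aux[OF bel(1) bel(4) uv(4-6) uv(1-3) e[symmetric]]
    by (cases v1 v2 rule: linorder_cases) auto
  then have "u1 = u2" using uv by simp
  then have "v1 *\<^sub>R y1 = v1 *\<^sub>R y2" using e \<open>v1 = v2\<close> by (metis add_left_cancel)
  then show ?thesis using uv(2) by simp
qed

text \<open>By \<open>chain_hull_cell\<close> both chains contain the centre \<open>m\<close> of the cell of \<open>z\<close>, and by \<open>exit_unique\<close>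
  the two points of the smaller simplexes to which \<open>z\<close> projects from \<open>m\<close> coincide. This common point
  has a smaller support than \<open>z\<close>, so induction on the support applies.\<close>

lemma chain_hull_Int:
  assumes "is_chain C" "is_chain D" "z \<in> convex hull C" "z \<in> convex hull D"
  shows "z \<in> convex hull (C \<inter> D)"
  using assms(3,4)
proof (induction "card (support G z)" arbitrary: z rule: less_induct)
  case less
  define m where "m = b z"
  have zP: "z \<in> P" using chain_hull_subset_P[OF assms(1)] less(2) by blast
  have mCD: "m \<in> C" "m \<in> D"
    using chain_hull_cell[OF assms(1) less(2)] chain_hull_cell[OF assms(2) less(3)] m_def by blast+
  show ?case
  proof (cases "z = m")
    case True
    then show ?thesis using mCD by (simp add: hull_inc)
  next
    case False
    obtain y1 u1 v1 where 1: "y1 \<in> convex hull (C \<inter> {p. below G p m \<and> p \<noteq> m})"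
       "u1 > 0" "v1 > 0" "u1 + v1 = 1" "z = u1 *\<^sub>R m + v1 *\<^sub>R y1"
      using chain_hull_cell[OF assms(1) less(2)] False m_def by blast
    obtain y2 u2 v2 where 2: "y2 \<in> convex hull (D \<inter> {p. below G p m \<and> p \<noteq> m})"
       "u2 > 0" "v2 > 0" "u2 + v2 = 1" "z = u2 *\<^sub>R m + v2 *\<^sub>R y2"
      using chain_hull_cell[OF assms(2) less(3)] False m_def by blast
    have m: "m \<in> P" using centre_in_P zP m_def by simp
    have mm: "b m = m" using centre_idem zP m_def by blast
    have strict: "y \<in> P \<and> below G y m \<and> \<not> same_signs G y m"
      if y: "y \<in> convex hull (C' \<inter> {p. below G p m \<and> p \<noteq> m})" and C': "is_chain C'" for y C'
    proof -
      have ch: "is_chain (C' \<inter> {p. below G p m \<and> p \<noteq> m})" by (rule chain_subset[OF C']) blast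
      have "y \<in> P" using chain_hull_subset_P[OF ch] y by blast
      moreover have "below G y m" by (rule chain_hull_below[OF _ y]) blast
      moreover have "b y \<noteq> m" using chain_hull_cell[OF ch y] by blast
      then have "\<not> same_signs G y m" using centre_cong[OF \<open>y \<in> P\<close> m] mm by metis
      ultimately show ?thesis by blast
    qed
    note s1 = strict[OF 1(1) assms(1)] and s2 = strict[OF 2(1) assms(2)]
    have eq: "y1 = y2"
      using exit_unique[OF m, of y1 y2 u1 v1 u2 v2] s1 s2 1 2 by auto
    have "same_signs G m z" using centre_signs zP m_def by simp
    then have "support G m = support G z"
      unfolding same_signs_def support_def by (metis sgn_0_0)
    then have "card (support G y1) < card (support G z)"
      using s1 card_support_less[of y1 m] by metis
    moreover have "y1 \<in> convex hull C" "y1 \<in> convex hull D"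
      using 1(1) 2(1) eq hull_mono[OF Int_lower1, of convex C] hull_mono[OF Int_lower1, of convex D] by blast+
    ultimately have "y1 \<in> convex hull (C \<inter> D)" using less(1) by blast
    moreover have "m \<in> convex hull (C \<inter> D)" using mCD by (simp add: hull_inc)
    ultimately show ?thesis
      unfolding 1(5) using 1(2-4) by (intro convexD[OF convex_convex_hull]) auto
  qed
qed

text \<open>Follow the ray from the centre of the cell of \<open>x\<close> through \<open>x\<close>, up to the first parameter at which a
  function of \<open>G\<close> that is not zero on the cell vanishes.\<close>

lemma exit_exists:
  assumes x: "x \<in> P" "x \<noteq> b x"
  obtains y u v where "y \<in> P" "below G y x" "\<not> same_signs G y x" "u > 0" "v > 0" "u + v = 1"
    "x = u *\<^sub>R b x + v *\<^sub>R y"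
proof -
  define m where "m = b x"
  have m: "m \<in> P" "same_signs G m x" "x \<noteq> m" using x centre_in_P centre_signs m_def by auto
  have sg: "sgn (g m) = sgn (g x)" if "g \<in> G" for g using m that by (simp add: same_signs_def)
  \<comment> \<open>the functions whose absolute value decreases along the ray; \<open>t g\<close> is the parameter of the
    zero of \<open>g\<close>, where the parameters of \<open>m\<close> and \<open>x\<close> are 0 and 1\<close>
  define H where "H = {g \<in> G. \<bar>g x\<bar> < \<bar>g m\<bar>}"
  define t where "t g = g m / (g m - g x)" for g :: "'a \<Rightarrow> real"
  define t0 where "t0 = Min (t ` H)"
  obtain g0 where "g0 \<in> G" "0 < g0 x" "g0 x < g0 m"
    using bounded_cells[OF x(1) m(1) same_signs_sym[OF m(2)] m(3)] by blast
  then have "g0 \<in> H" by (simp add: H_def)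
  then have H: "finite H" "H \<noteq> {}" using finite_G by (auto simp: H_def)
  have t1: "t g > 1" if "g \<in> H" for g
  proof -
    have s: "sgn (g m) = sgn (g x)" "\<bar>g x\<bar> < \<bar>g m\<bar>" using that sg by (auto simp: H_def)
    consider "g m > 0" "g x > 0" "g x < g m" | "g m < 0" "g x < 0" "g m < g x"
      using s by (auto simp: sgn_if abs_if split: if_splits)
    then show ?thesis by cases (auto simp: t_def field_simps)
  qed
  obtain h where h: "h \<in> H" "t0 = t h" using Min_in[of "t ` H"] H t0_def by (metis finite_imageI imageE image_is_empty)
  have t0: "t0 > 1" using h t1 by simp
  have t0_le: "t0 \<le> t g" if "g \<in> H" for g using that H by (simp add: t0_def)
  define y where "y = (1 - t0) *\<^sub>R m + t0 *\<^sub>R x"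
  have gy: "g y = g m + t0 * (g x - g m)" if "g \<in> G" for g
    using affine_funD[OF affine_G[OF that], of "1 - t0" t0 m x] by (simp add: y_def algebra_simps)
  have bel: "below G y x"
    unfolding below_alt
  proof
    fix g assume g: "g \<in> G"
    show "(g x = 0 \<longrightarrow> g y = 0) \<and> (0 < g x \<longrightarrow> 0 \<le> g y) \<and> (g x < 0 \<longrightarrow> g y \<le> 0)"
    proof (cases "g \<in> H")
      case False
      then have ab: "\<bar>g m\<bar> \<le> \<bar>g x\<bar>" using g by (auto simp: H_def)
      consider "g m = 0" "g x = 0" | "g m > 0" "g x > 0" "g m \<le> g x" | "g m < 0" "g x < 0" "g x \<le> g m"
        using sg[OF g] ab by (auto simp: sgn_if abs_if split: if_splits)
      then show ?thesis
      proof cases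
        case 3
        then have "t0 * (g x - g m) \<le> 0" using t0 by (simp add: mult_nonneg_nonpos)
        then show ?thesis using gy[OF g] 3 by simp
      qed (use gy[OF g] t0 in auto)
    next
      case True
      then have ab: "\<bar>g x\<bar> < \<bar>g m\<bar>" by (auto simp: H_def)
      note le = t0_le[OF True]
      consider "g m > 0" "g x > 0" "g x < g m" | "g m < 0" "g x < 0" "g m < g x"
        using sg[OF g] ab by (auto simp: sgn_if abs_if split: if_splits)
      then show ?thesis
      proof cases
        case 1
        then have "t0 * (g m - g x) \<le> g m" using le by (simp add: t_def field_simps)
        then show ?thesis using gy[OF g] 1 by (simp add: algebra_simps)
      next
        case 2
        then have "t0 * (g m - g x) \<ge> g m" using le by (simp add: t_def field_simps)
        then show ?thesis using gy[OF g] 2 by (simp add: algebra_simps)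
      qed
    qed
  qed
  have hG: "h \<in> G" and hx: "h x \<noteq> 0" "h m \<noteq> h x"
    using h sg[of h] by (auto simp: H_def sgn_0_0)
  have "h y = 0" using gy[OF hG] h hx by (simp add: t_def field_simps)
  then have ns: "\<not> same_signs G y x" using hG hx unfolding same_signs_def by (metis sgn_0_0)
  have "y \<in> X" unfolding y_def using affine_X m x P_subset by (simp add: affine_def subset_iff)
  then have "y \<in> P" using P_closed x bel by blast
  moreover have "(1 - 1 / t0) *\<^sub>R m + (1 / t0) *\<^sub>R y =
      ((1 - 1 / t0) + (1 / t0) * (1 - t0)) *\<^sub>R m + ((1 / t0) * t0) *\<^sub>R x"
    by (simp only: y_def scaleR_add_right scaleR_scaleR scaleR_add_left add.assoc)
  moreover have "(1 - 1 / t0) + (1 / t0) * (1 - t0) = 0" "(1 / t0) * t0 = 1"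
    using t0 by (simp_all add: field_simps)
  ultimately have "y \<in> P" "x = (1 - 1 / t0) *\<^sub>R b x + (1 / t0) *\<^sub>R y"
    unfolding m_def by simp_all
  moreover have "1 - 1 / t0 > 0" "1 / t0 > 0" using t0 by auto
  ultimately show ?thesis using that[of y "1 - 1 / t0" "1 / t0"] bel ns by simp
qed

text \<open>By \<open>exit_exists\<close> a point that is not a centre is a combination of its centre and a point in a proper face of its cell, for
  which a chain is known by induction on the support.\<close>

lemma in_chain_hull:
  assumes "x \<in> P"
  shows "\<exists>C. is_chain C \<and> (\<forall>p\<in>C. below G p x) \<and> x \<in> convex hull C"
  using assms
proof (induction "card (support G x)" arbitrary: x rule: less_induct)
  case less
  have bx: "b x \<in> b ` P" "below G (b x) x" using less(2) same_signs_imp_below[OF centre_signs] by auto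
  have bb: "below G p p" for p :: 'a by (simp add: below_def)
  show ?case
  proof (cases "x = b x")
    case True
    then have "is_chain {x} \<and> (\<forall>p\<in>{x}. below G p x) \<and> x \<in> convex hull {x}"
      using bx bb by (auto simp: is_chain_def)
    then show ?thesis by blast
  next
    case False
    obtain y u v where y: "y \<in> P" "below G y x" "\<not> same_signs G y x" "u > 0" "v > 0" "u + v = 1"
      "x = u *\<^sub>R b x + v *\<^sub>R y" using exit_exists[OF less(2) False] by blast
    have "card (support G y) < card (support G x)"
      using y by (intro card_support_less)
    then obtain C where C: "is_chain C" "\<forall>p\<in>C. below G p y" "y \<in> convex hull C"
      using less y by blast
    have C': "below G p (b x)" if "p \<in> C" for p
      using C(2) that below_trans[OF below_trans[OF _ y(2)] same_signs_imp_below[OF same_signs_sym[OF centre_signs[OF less(2)]]]] by blast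
    then have "is_chain (insert (b x) C)" using C bx bb by (auto simp: is_chain_def)
    moreover have "\<forall>p\<in>insert (b x) C. below G p x" using C' bx below_trans[of G _ "b x" x] by blast
    moreover have "x \<in> convex hull (insert (b x) C)"
    proof -
      have "b x \<in> convex hull (insert (b x) C)" "y \<in> convex hull (insert (b x) C)"
        using C hull_mono[of C "insert (b x) C" convex] by (auto simp: hull_inc)
      then have "u *\<^sub>R b x + v *\<^sub>R y \<in> convex hull (insert (b x) C)"
        using y(4-6) by (intro convexD[OF convex_convex_hull]) auto
      then show ?thesis using y(7) by simp
    qed
    ultimately show ?thesis by blast
  qed
qed

definition barycentric :: "'a set set" where
  "barycentric = {convex hull C | C. is_chain C}"

lemma barycentric_finite: "finite barycentric"
proof -
  have "barycentric \<subseteq> (\<lambda>C. convex hull C) ` Pow (b ` P)"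
    by (auto simp: barycentric_def is_chain_def)
  then show ?thesis using finite_centres finite_subset by blast
qed

lemma barycentric_Union: "\<Union>barycentric = P"
proof
  show "\<Union>barycentric \<subseteq> P" unfolding barycentric_def using chain_hull_subset_P by auto
  show "P \<subseteq> \<Union>barycentric" unfolding barycentric_def using in_chain_hull by blast
qed

lemma barycentric_face:
  assumes "S \<in> barycentric" "F face_of S"
  shows "F \<in> barycentric"
proof -
  obtain C where C: "is_chain C" "S = convex hull C" using assms by (auto simp: barycentric_def)
  have "F = convex hull (F \<inter> C)"
    using face_of_convex_hull_eq_hull[OF chain_finite[OF C(1)]] assms(2) C(2) by blast
  moreover have "is_chain (F \<inter> C)" by (rule chain_subset[OF C(1)]) blast
  ultimately show ?thesis unfolding barycentric_def by blast
qed

lemma barycentric_Int: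
  assumes "S \<in> barycentric" "T \<in> barycentric"
  shows "(S \<inter> T) face_of S"
proof -
  obtain C D where C: "is_chain C" "S = convex hull C" and D: "is_chain D" "T = convex hull D"
    using assms by (auto simp: barycentric_def)
  have "S \<inter> T = convex hull (C \<inter> D)"
    using chain_hull_Int[OF C(1) D(1)] C(2) D(2) hull_mono[of "C \<inter> D" C convex] hull_mono[of "C \<inter> D" D convex] by blast
  then show ?thesis
    using C convex_hull_subset_face_of[OF chain_finite chain_affine_independent, of C "C \<inter> D"] by auto
qed

lemma barycentric_subset_cell:
  assumes "T \<in> barycentric" "T \<noteq> {}"
  obtains p where "p \<in> P" "\<forall>x\<in>T. x \<in> P \<and> below G x p"
proof -
  obtain C where C: "is_chain C" "T = convex hull C" using assms by (auto simp: barycentric_def)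
  then have "C \<noteq> {}" using assms by auto
  then obtain m where m: "m \<in> C" "\<forall>p\<in>C. below G p m" using chain_top[OF C(1)] by blast
  have "\<forall>x\<in>T. x \<in> P \<and> below G x m"
    using chain_hull_below[OF m(2)] chain_hull_subset_P[OF C(1)] unfolding C(2) by blast
  with chain_in_P[OF C(1) m(1)] show ?thesis by (rule that)
qed

end

section \<open>Affine functions with coefficients in a subring\<close>

abbreviation coord :: "pt \<Rightarrow> nat \<Rightarrow> real" where
  "coord \<equiv> Poly_Mapping.lookup"

lemma coord_scaleR [simp]: "coord (r *\<^sub>R x) i = r * coord x i"
proof -
  have "finite {i. r * coord x i \<noteq> 0}"
    by (rule finite_subset[OF _ finite_keys[of x]]) (auto simp: in_keys_iff)
  then show ?thesis by (simp add: scaleR_poly_mapping_def)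
qed

definition pt_of :: "nat \<Rightarrow> (nat \<Rightarrow> real) \<Rightarrow> pt" where
  "pt_of n f = Abs_poly_mapping (\<lambda>i. if i < n then f i else 0)"

lemma coord_pt_of [simp]: "coord (pt_of n f) i = (if i < n then f i else 0)"
proof -
  have "finite {i. (if i < n then f i else 0) \<noteq> 0}"
    by (rule finite_subset[of _ "{..<n}"]) auto
  then show ?thesis by (simp add: pt_of_def)
qed

lemma Rn_iff: "x \<in> Rn n \<longleftrightarrow> (\<forall>i\<ge>n. coord x i = 0)"
  by (simp add: Rn_def in_keys_iff subset_iff linorder_not_less[symmetric]) blast

lemma pt_of_in_Rn [simp]: "pt_of n f \<in> Rn n" by (simp add: Rn_iff)

lemma Rn_eqI: "\<lbrakk>x \<in> Rn n; y \<in> Rn n; \<And>i. i < n \<Longrightarrow> coord x i = coord y i\<rbrakk> \<Longrightarrow> x = y"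
  by (rule poly_mapping_eqI) (metis Rn_iff not_less)

lemma affine_Rn: "affine (Rn n)"
  by (auto simp: affine_def Rn_iff lookup_add)

definition subring :: "real set \<Rightarrow> bool" where
  "subring A \<longleftrightarrow> 1 \<in> A \<and> (\<forall>x\<in>A. \<forall>y\<in>A. x - y \<in> A \<and> x * y \<in> A)"

lemma subring_Rats: "subring \<rat>" and subring_Ints: "subring \<int>"
  by (auto simp: subring_def)

lemma subring_one: "subring A \<Longrightarrow> 1 \<in> A"
  and subring_diff: "subring A \<Longrightarrow> x \<in> A \<Longrightarrow> y \<in> A \<Longrightarrow> x - y \<in> A"
  and subring_mult: "subring A \<Longrightarrow> x \<in> A \<Longrightarrow> y \<in> A \<Longrightarrow> x * y \<in> A"
  by (simp_all add: subring_def)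

lemma subring_zero: "subring A \<Longrightarrow> 0 \<in> A"
  using subring_diff[of A 1 1] subring_one[of A] by simp

lemma subring_add: "subring A \<Longrightarrow> x \<in> A \<Longrightarrow> y \<in> A \<Longrightarrow> x + y \<in> A"
  using subring_diff[of A x "0 - y"] subring_diff[of A 0 y] subring_zero[of A] by simp

text \<open>The two coefficient rings of interest are \<open>\<rat>\<close>, for the inequalities that cut out polyhedra, and \<open>\<int>\<close>,
  for the pieces of \<open>\<int>\<close>-maps. The functions depend on the first \<open>n\<close> coordinates only, but are defined
  on all points.\<close>

definition affine_form :: "real set \<Rightarrow> nat \<Rightarrow> (pt \<Rightarrow> real) set" where
  "affine_form A n = {k. \<exists>a c. (\<forall>i. a i \<in> A) \<and> c \<in> A \<and> k = (\<lambda>x. (\<Sum>i<n. a i * coord x i) + c)}"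

lemma affine_formI:
  "\<lbrakk>\<And>i. a i \<in> A; c \<in> A\<rbrakk> \<Longrightarrow> (\<lambda>x. (\<Sum>i<n. a i * coord x i) + c) \<in> affine_form A n"
  unfolding affine_form_def by (intro CollectI exI[of _ a] exI[of _ c]) simp

lemma affine_formE:
  assumes "k \<in> affine_form A n"
  obtains a c where "\<forall>i. a i \<in> A" "c \<in> A" "k = (\<lambda>x. (\<Sum>i<n. a i * coord x i) + c)"
  using assms unfolding affine_form_def by (elim CollectE exE conjE)

lemma affine_form_mono:
  assumes "A \<subseteq> B" shows "affine_form A n \<subseteq> affine_form B n"
proof
  fix k assume "k \<in> affine_form A n"
  then show "k \<in> affine_form B n"
    using assms by (elim affine_formE) (simp add: affine_formI subset_iff)
qed

lemma affine_form_const: "subring A \<Longrightarrow> c \<in> A \<Longrightarrow> (\<lambda>x. c) \<in> affine_form A n"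
  using affine_formI[of "\<lambda>i. 0" A c n] subring_zero[of A] by simp

lemma affine_form_coord: "subring A \<Longrightarrow> i < n \<Longrightarrow> (\<lambda>x. coord x i) \<in> affine_form A n"
  using affine_formI[of "\<lambda>j. if j = i then 1 else 0" A 0 n] subring_zero[of A] subring_one[of A]
  by (simp add: if_distrib[of "\<lambda>a. a * _"] sum.delta cong: if_cong)

lemma affine_form_add:
  assumes "subring A" "k \<in> affine_form A n" "l \<in> affine_form A n"
  shows "(\<lambda>x. k x + l x) \<in> affine_form A n"
proof -
  obtain a c a' c' where a: "\<forall>i. a i \<in> A" "c \<in> A" "k = (\<lambda>x. (\<Sum>i<n. a i * coord x i) + c)"
    "\<forall>i. a' i \<in> A" "c' \<in> A" "l = (\<lambda>x. (\<Sum>i<n. a' i * coord x i) + c')"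
    using assms unfolding affine_form_def by blast
  have "(\<lambda>x. k x + l x) = (\<lambda>x. (\<Sum>i<n. (a i + a' i) * coord x i) + (c + c'))"
    by (simp add: a(3,6) sum.distrib algebra_simps)
  then show ?thesis using affine_formI[of "\<lambda>i. a i + a' i" A "c + c'" n] a subring_add[OF assms(1)] by simp
qed

lemma affine_form_scale:
  assumes "subring A" "k \<in> affine_form A n" "r \<in> A"
  shows "(\<lambda>x. r * k x) \<in> affine_form A n"
proof -
  obtain a c where a: "\<forall>i. a i \<in> A" "c \<in> A" "k = (\<lambda>x. (\<Sum>i<n. a i * coord x i) + c)"
    using assms unfolding affine_form_def by blast
  have "(\<lambda>x. r * k x) = (\<lambda>x. (\<Sum>i<n. (r * a i) * coord x i) + r * c)"
    by (simp add: a(3) sum_distrib_left algebra_simps)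
  then show ?thesis using affine_formI[of "\<lambda>i. r * a i" A "r * c" n] a assms subring_mult[OF assms(1)] by simp
qed

lemma affine_form_diff:
  assumes A: "subring A" and "k \<in> affine_form A n" "l \<in> affine_form A n"
  shows "(\<lambda>x. k x - l x) \<in> affine_form A n"
  using affine_form_add[OF A assms(2) affine_form_scale[OF A assms(3), of "-1"]]
    subring_diff[OF A subring_zero[OF A] subring_one[OF A]] by simp

lemma affine_form_compose:
  assumes A: "subring A" and k: "k \<in> affine_form A m" and h: "\<And>i. i < m \<Longrightarrow> (\<lambda>x. coord (f x) i) \<in> affine_form A n"
  shows "(\<lambda>x. k (f x)) \<in> affine_form A n"
proof -
  obtain a c where a: "\<forall>i. a i \<in> A" "c \<in> A" "k = (\<lambda>x. (\<Sum>i<m. a i * coord x i) + c)"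
    using k unfolding affine_form_def by blast
  have "(\<lambda>x. \<Sum>i<j. a i * coord (f x) i) \<in> affine_form A n" if "j \<le> m" for j
    using that
  proof (induction j)
    case 0
    then show ?case using affine_form_const[OF A subring_zero[OF A]] by simp
  next
    case (Suc j)
    then show ?case
      using affine_form_add[OF A _ affine_form_scale[OF A h[of j], of "a j"]] a by simp
  qed
  then show ?thesis using affine_form_add[OF A _ affine_form_const[OF A a(2)]] unfolding a(3) by simp
qed

lemma affine_fun_affine_form:
  assumes "k \<in> affine_form A n" shows "affine_fun k"
proof -
  obtain a c where a: "k = (\<lambda>x. (\<Sum>i<n. a i * coord x i) + c)"
    using assms unfolding affine_form_def by blast
  show ?thesis unfolding affine_fun_def
  proof (intro allI impI)
    fix x y :: pt and u v :: real assume "u + v = 1"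
    then have "u * c + v * c = c" by (metis distrib_right mult_1)
    then show "k (u *\<^sub>R x + v *\<^sub>R y) = u * k x + v * k y"
      by (simp add: a lookup_add sum.distrib sum_distrib_left algebra_simps)
  qed
qed

section \<open>Rational points in cells\<close>

text \<open>The vectors \<open>q 0, q 1, \<dots>\<close> are rational, tend to \<open>x\<close>, and satisfy every rational affine equation that
  \<open>x\<close> satisfies.\<close>

definition rational_approximation :: "nat \<Rightarrow> (nat \<Rightarrow> real) \<Rightarrow> (nat \<Rightarrow> nat \<Rightarrow> real) \<Rightarrow> bool" where
  "rational_approximation n x q \<longleftrightarrow>
     (\<forall>k i. q k i \<in> \<rat>) \<and> (\<forall>i<n. (\<lambda>k. q k i) \<longlonglongrightarrow> x i) \<and>
     (\<forall>a c k. (\<forall>i. a i \<in> \<rat>) \<longrightarrow> c \<in> \<rat> \<longrightarrow> (\<Sum>i<n. a i * x i) + c = 0 \<longrightarrow>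
        (\<Sum>i<n. a i * q k i) + c = 0)"

lemma rational_approximationD:
  assumes "rational_approximation n x q"
  shows "q k i \<in> \<rat>" "i < n \<Longrightarrow> (\<lambda>k. q k i) \<longlonglongrightarrow> x i"
    "\<lbrakk>\<forall>i. a i \<in> \<rat>; c \<in> \<rat>; (\<Sum>i<n. a i * x i) + c = 0\<rbrakk> \<Longrightarrow> (\<Sum>i<n. a i * q k i) + c = 0"
  using assms by (simp_all add: rational_approximation_def)

lemma rational_approximationI:
  assumes "\<And>k i. q k i \<in> \<rat>" "\<And>i. i < n \<Longrightarrow> (\<lambda>k. q k i) \<longlonglongrightarrow> x i"
    "\<And>a c k. \<lbrakk>\<forall>i. a i \<in> \<rat>; c \<in> \<rat>; (\<Sum>i<n. a i * x i) + c = 0\<rbrakk> \<Longrightarrow> (\<Sum>i<n. a i * q k i) + c = 0"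
  shows "rational_approximation n x q"
  using assms by (simp add: rational_approximation_def)

text \<open>Induction on the number of coordinates. If the new coordinate is a rational affine function of the
  previous ones, then the same function determines it for the approximating vectors. Otherwise it has
  coefficient zero in every rational equation for \<open>x\<close>, and any rational sequence that tends to it will do.\<close>

lemma rational_approximation_exists: "\<exists>q. rational_approximation n x q"
proof (induction n)
  case 0
  have "rational_approximation 0 x (\<lambda>k i. 0)" by (rule rational_approximationI) auto
  then show ?case by (rule exI[of _ "\<lambda>k i. 0"])
next
  case (Suc n)
  then obtain q where "rational_approximation n x q" ..
  note q = rational_approximationD[OF this]
  show ?case
  proof (cases "\<exists>a c. (\<forall>i. a i \<in> \<rat>) \<and> c \<in> \<rat> \<and> x n = (\<Sum>i<n. a i * x i) + c")
    case True
    then obtain a c where a: "\<forall>i. a i \<in> \<rat>" "c \<in> \<rat>" "x n = (\<Sum>i<n. a i * x i) + c"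
      by (elim exE conjE)
    define q' where "q' k = (q k)(n := (\<Sum>i<n. a i * q k i) + c)" for k
    have "q' k i \<in> \<rat>" for k i using a q(1) by (auto simp: q'_def intro!: Rats_add Rats_sum)
    moreover have "(\<lambda>k. q' k i) \<longlonglongrightarrow> x i" if "i < Suc n" for i
    proof (cases "i = n")
      case True
      have "(\<lambda>k. (\<Sum>i<n. a i * q k i) + c) \<longlonglongrightarrow> (\<Sum>i<n. a i * x i) + c"
        by (intro tendsto_add tendsto_sum tendsto_mult tendsto_const q(2)) auto
      then show ?thesis using True a(3) by (simp add: q'_def)
    next
      case False
      then show ?thesis using that q(2)[of i] by (simp add: q'_def)
    qed
    moreover have "(\<Sum>i<Suc n. a' i * q' k i) + c' = 0"
      if a': "\<forall>i. a' i \<in> \<rat>" "c' \<in> \<rat>" "(\<Sum>i<Suc n. a' i * x i) + c' = 0" for a' c' k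
    proof -
      have e: "(\<Sum>i<n. a' i * y i) + a' n * ((\<Sum>i<n. a i * y i) + c) + c'
          = (\<Sum>i<n. (a' i + a' n * a i) * y i) + (a' n * c + c')" for y :: "nat \<Rightarrow> real"
        by (simp add: sum.distrib sum_distrib_left algebra_simps)
      have "(\<Sum>i<n. (a' i + a' n * a i) * x i) + (a' n * c + c') = 0"
        using a'(3) e[of x] by (simp add: a(3))
      then have "(\<Sum>i<n. (a' i + a' n * a i) * q k i) + (a' n * c + c') = 0"
        using a a' by (intro q(3)) auto
      then show ?thesis using e[of "q k"] by (simp add: q'_def)
    qed
    ultimately have "rational_approximation (Suc n) x q'" by (rule rational_approximationI)
    then show ?thesis by (rule exI[of _ q'])
  next
    case False
    have "\<exists>r\<in>\<rat>. x n < r \<and> r < x n + 1 / real (Suc k)" for k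
      by (rule Rats_dense_in_real) simp
    then have "\<forall>k. \<exists>r. r \<in> \<rat> \<and> x n < r \<and> r < x n + 1 / real (Suc k)" by blast
    then obtain r where "\<forall>k. r k \<in> \<rat> \<and> x n < r k \<and> r k < x n + 1 / real (Suc k)"
      by (rule choice[THEN exE])
    then have r: "\<And>k. r k \<in> \<rat>" "\<And>k. x n < r k" "\<And>k. r k < x n + 1 / real (Suc k)" by simp_all
    have "(\<lambda>k. x n + 1 / real (Suc k)) \<longlonglongrightarrow> x n + 0"
      by (intro tendsto_add tendsto_const) (use LIMSEQ_inverse_real_of_nat in \<open>simp add: inverse_eq_divide\<close>)
    then have rl: "r \<longlonglongrightarrow> x n"
      using r by (intro tendsto_sandwich[of "\<lambda>k. x n" r sequentially "\<lambda>k. x n + 1 / real (Suc k)"])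
        (auto simp: less_imp_le)
    define q' where "q' k = (q k)(n := r k)" for k
    have "q' k i \<in> \<rat>" for k i using r q(1) by (auto simp: q'_def)
    moreover have "(\<lambda>k. q' k i) \<longlonglongrightarrow> x i" if "i < Suc n" for i
      using that q(2)[of i] rl by (cases "i = n") (auto simp: q'_def)
    moreover have "(\<Sum>i<Suc n. a' i * q' k i) + c' = 0"
      if a': "\<forall>i. a' i \<in> \<rat>" "c' \<in> \<rat>" "(\<Sum>i<Suc n. a' i * x i) + c' = 0" for a' c' k
    proof -
      have a0: "a' n = 0"
      proof (rule ccontr)
        assume nz: "a' n \<noteq> 0"
        have "a' n * x n = - ((\<Sum>i<n. a' i * x i) + c')" using a'(3) by simp
        then have "x n = - ((\<Sum>i<n. a' i * x i) + c') / a' n" using nz by (simp add: field_simps)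
        also have "\<dots> = (\<Sum>i<n. (- a' i / a' n) * x i) + (- c' / a' n)"
          by (simp add: sum_divide_distrib sum_negf add_divide_distrib diff_divide_distrib)
        finally show False using False a' by (metis Rats_divide Rats_minus_iff)
      qed
      then have "(\<Sum>i<n. a' i * q k i) + c' = 0" using a' by (intro q(3)) auto
      then show ?thesis using a0 by (simp add: q'_def)
    qed
    ultimately have "rational_approximation (Suc n) x q'" by (rule rational_approximationI)
    then show ?thesis by (rule exI[of _ q'])
  qed
qed

text \<open>Functions that vanish at \<open>x\<close> vanish at all approximating vectors, and for the finitely many others
  the sign is eventually that at \<open>x\<close>.\<close>

lemma rational_point_same_signs:
  assumes G: "finite G" "G \<subseteq> affine_form \<rat> n" 
  shows "\<exists>q\<in>Rn n. (\<forall>i. coord q i \<in> \<rat>) \<and> same_signs G q x"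
proof -
  obtain q where "rational_approximation n (coord x) q"
    using rational_approximation_exists ..
  note q = rational_approximationD[OF this]
  have "\<forall>\<^sub>F k in sequentially. sgn (g (pt_of n (q k))) = sgn (g x)" if "g \<in> G" for g
  proof -
    have "g \<in> affine_form \<rat> n" using G that by blast
    then obtain a c where a: "\<forall>i. a i \<in> \<rat>" "c \<in> \<rat>" "g = (\<lambda>x. (\<Sum>i<n. a i * coord x i) + c)"
      by (rule affine_formE)
    have "(\<lambda>k. (\<Sum>i<n. a i * q k i) + c) \<longlonglongrightarrow> (\<Sum>i<n. a i * coord x i) + c"
      by (intro tendsto_add tendsto_sum tendsto_mult tendsto_const q(2)) auto
    then have lim: "(\<lambda>k. g (pt_of n (q k))) \<longlonglongrightarrow> g x" by (simp add: a(3))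
    consider "g x = 0" | "g x > 0" | "g x < 0" by linarith
    then show ?thesis
    proof cases
      case 1
      then have "g (pt_of n (q k)) = 0" for k using q(3)[OF a(1,2)] by (simp add: a(3))
      then show ?thesis using 1 by simp
    next
      case 2
      then show ?thesis using order_tendstoD(1)[OF lim 2] by (auto elim: eventually_mono)
    next
      case 3
      then show ?thesis using order_tendstoD(2)[OF lim 3] by (auto elim: eventually_mono)
    qed
  qed
  then have "\<forall>\<^sub>F k in sequentially. \<forall>g\<in>G. sgn (g (pt_of n (q k))) = sgn (g x)"
    using G(1) by (simp add: eventually_ball_finite_distrib)
  then have "\<exists>k. \<forall>g\<in>G. sgn (g (pt_of n (q k))) = sgn (g x)"
    by (rule eventually_happens'[OF sequentially_bot])
  then obtain k where "\<forall>g\<in>G. sgn (g (pt_of n (q k))) = sgn (g x)" ..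
  then show ?thesis
    using q(1) by (intro bexI[of _ "pt_of n (q k)"]) (auto simp: same_signs_def)
qed

section \<open>Rational simplexes are cut out by rational inequalities\<close>

definition h_polyhedron :: "nat \<Rightarrow> pt set \<Rightarrow> bool" where
  "h_polyhedron n S \<longleftrightarrow> (\<exists>G. finite G \<and> G \<subseteq> affine_form \<rat> n \<and> S = {x \<in> Rn n. \<forall>g\<in>G. 0 \<le> g x})"

definition coord_bounded :: "pt set \<Rightarrow> bool" where
  "coord_bounded S \<longleftrightarrow> (\<exists>B. \<forall>x\<in>S. \<forall>i. \<bar>coord x i\<bar> \<le> B)"

lemma coord_boundedE:
  assumes "coord_bounded S"
  obtains B where "\<forall>x\<in>S. \<forall>i. \<bar>coord x i\<bar> \<le> B"
  using assms unfolding coord_bounded_def by blast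

lemma coord_bounded_Union:
  assumes "finite \<F>" "\<And>S. S \<in> \<F> \<Longrightarrow> coord_bounded S"
  shows "coord_bounded (\<Union>\<F>)"
  using assms
proof (induction \<F>)
  case (insert S \<F>)
  have "coord_bounded S" "coord_bounded (\<Union>\<F>)" using insert by auto
  then obtain B B' where "\<forall>x\<in>S. \<forall>i. \<bar>coord x i\<bar> \<le> B" "\<forall>x\<in>\<Union>\<F>. \<forall>i. \<bar>coord x i\<bar> \<le> B'"
    by (elim coord_boundedE)
  then have "\<forall>x\<in>\<Union>(insert S \<F>). \<forall>i. \<bar>coord x i\<bar> \<le> max B B'" by (auto simp: le_max_iff_disj)
  then show ?case unfolding coord_bounded_def by (rule exI)
qed (simp add: coord_bounded_def)

lemma coord_bounded_hull:
  assumes "finite V" shows "coord_bounded (convex hull V)"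
proof -
  have "coord_bounded {v}" for v
  proof -
    have "range (coord v) \<subseteq> insert 0 (coord v ` Poly_Mapping.keys v)" by (auto simp: in_keys_iff)
    then have "finite (range (coord v))" by (rule finite_subset) simp
    then have "\<bar>coord v i\<bar> \<le> Max (abs ` range (coord v))" for i
      by (rule Max_ge[OF finite_imageI imageI[OF rangeI]])
    then have "\<forall>x\<in>{v}. \<forall>i. \<bar>coord x i\<bar> \<le> Max (abs ` range (coord v))" by simp
    then show ?thesis unfolding coord_bounded_def by (rule exI)
  qed
  then have "coord_bounded (\<Union>((\<lambda>v. {v}) ` V))" using assms by (intro coord_bounded_Union) auto
  then have "coord_bounded V" by simp
  then obtain B where B: "\<forall>x\<in>V. \<forall>i. \<bar>coord x i\<bar> \<le> B" by (rule coord_boundedE)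
  have "convex {x. \<forall>i. \<bar>coord x i\<bar> \<le> B}"
    unfolding convex_def
  proof (clarify)
    fix x y :: pt and u v :: real and i
    assume x: "\<forall>i. \<bar>coord x i\<bar> \<le> B" "\<forall>i. \<bar>coord y i\<bar> \<le> B" and uv: "0 \<le> u" "0 \<le> v" "u + v = 1"
    have "\<bar>u * coord x i + v * coord y i\<bar> \<le> u * \<bar>coord x i\<bar> + v * \<bar>coord y i\<bar>"
      using uv by (metis abs_mult abs_of_nonneg abs_triangle_ineq)
    also have "\<dots> \<le> B" by (rule convex_bound_le) (use x uv in auto)
    finally show "\<bar>coord (u *\<^sub>R x + v *\<^sub>R y) i\<bar> \<le> B" by (simp add: lookup_add)
  qed
  then have "convex hull V \<subseteq> {x. \<forall>i. \<bar>coord x i\<bar> \<le> B}" using B by (intro hull_minimal) auto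
  then show ?thesis unfolding coord_bounded_def by blast
qed

lemma real_between_finite_sets:
  fixes L U :: "real set"
  assumes "finite L" "finite U" "\<And>l u. l \<in> L \<Longrightarrow> u \<in> U \<Longrightarrow> l \<le> u"
  shows "\<exists>t. (\<forall>l\<in>L. l \<le> t) \<and> (\<forall>u\<in>U. t \<le> u)"
proof (cases "L = {}")
  case True
  then show ?thesis using assms(2) by (cases "U = {}") (auto intro!: exI[of _ "Min U"])
next
  case False
  then show ?thesis using assms by (intro exI[of _ "Max L"]) auto
qed

text \<open>The constraints with \<open>c k > 0\<close> are lower bounds for \<open>t\<close> and those with \<open>c k < 0\<close> are upper bounds, and a
  suitable \<open>t\<close> exists if and only if every lower bound is at most every upper bound.\<close>

lemma Fourier_Motzkin:
  fixes a c :: "'k \<Rightarrow> real"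
  assumes "finite K"
  shows "(\<exists>t. \<forall>k\<in>K. 0 \<le> a k + c k * t) \<longleftrightarrow>
    (\<forall>k\<in>K. c k = 0 \<longrightarrow> 0 \<le> a k) \<and> (\<forall>k\<in>K. \<forall>l\<in>K. 0 < c k \<longrightarrow> c l < 0 \<longrightarrow> 0 \<le> c k * a l - c l * a k)"
  (is "?lhs \<longleftrightarrow> ?rhs")
proof
  assume ?lhs
  then obtain t where t: "\<And>k. k \<in> K \<Longrightarrow> 0 \<le> a k + c k * t" by blast
  have "0 \<le> c k * a l - c l * a k" if "k \<in> K" "l \<in> K" "0 < c k" "c l < 0" for k l
  proof -
    have "0 \<le> c k * (a l + c l * t)" using t that by simp
    moreover have "0 \<le> (- c l) * (a k + c k * t)" using t that by (intro mult_nonneg_nonneg) auto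
    ultimately show ?thesis by (simp add: algebra_simps)
  qed
  moreover have "0 \<le> a k" if "k \<in> K" "c k = 0" for k using t[OF that(1)] that by simp
  ultimately show ?rhs by blast
next
  assume r: ?rhs
  define L where "L = (\<lambda>k. - a k / c k) ` {k \<in> K. 0 < c k}"
  define U where "U = (\<lambda>k. - a k / c k) ` {k \<in> K. c k < 0}"
  have "l \<le> u" if "l \<in> L" "u \<in> U" for l u
  proof -
    obtain k k' where k: "k \<in> K" "0 < c k" "l = - a k / c k" "k' \<in> K" "c k' < 0" "u = - a k' / c k'"
      using \<open>l \<in> L\<close> \<open>u \<in> U\<close> unfolding L_def U_def by blast
    have "0 \<le> c k * a k' - c k' * a k" using r k by blast
    moreover define d where "d = - c k'"
    ultimately have "(- a k) * d \<le> a k' * c k" "d > 0" using k by (simp_all add: algebra_simps)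
    then have "- a k / c k \<le> a k' / d" using k(2) by (simp add: field_simps)
    then show ?thesis using k by (simp add: d_def)
  qed
  moreover have "finite L" "finite U" using assms by (auto simp: L_def U_def)
  ultimately obtain t where t: "\<forall>l\<in>L. l \<le> t" "\<forall>u\<in>U. t \<le> u" using real_between_finite_sets by blast
  have "0 \<le> a k + c k * t" if k: "k \<in> K" for k
  proof -
    consider "c k = 0" | "0 < c k" | "c k < 0" by linarith
    then show ?thesis
    proof cases
      case 1 then show ?thesis using r k by simp
    next
      case 2
      then have "- a k / c k \<le> t" using t k by (auto simp: L_def)
      then show ?thesis using 2 by (simp add: field_simps)
    next
      case 3
      then have "t \<le> - a k / c k" using t k by (auto simp: U_def)
      then show ?thesis using 3 by (simp add: field_simps)
    qed
  qed
  then show ?lhs by blast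
qed

lemma h_polyhedron_projection:
  assumes K: "finite K" "\<And>a c. (a, c) \<in> K \<Longrightarrow> a \<in> affine_form \<rat> n \<and> c \<in> \<rat>"
  shows "h_polyhedron n {x \<in> Rn n. \<exists>t. \<forall>k\<in>K. 0 \<le> fst k x + snd k * t}"
proof -
  define G where "G = fst ` {k \<in> K. snd k = 0} \<union>
    (\<lambda>(k, l). \<lambda>x. snd k * fst l x - snd l * fst k x) ` ({k \<in> K. 0 < snd k} \<times> {l \<in> K. snd l < 0})"
  have "finite G" using K(1) by (simp add: G_def)
  moreover have "G \<subseteq> affine_form \<rat> n"
    using K(2) by (auto simp: G_def intro!: affine_form_diff affine_form_scale subring_Rats)
  moreover have "(\<exists>t. \<forall>k\<in>K. 0 \<le> fst k x + snd k * t) \<longleftrightarrow> (\<forall>g\<in>G. 0 \<le> g x)" for x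
    unfolding Fourier_Motzkin[OF K(1), of "\<lambda>k. fst k x" snd] G_def by (auto simp: ball_Un; force)
  ultimately show ?thesis unfolding h_polyhedron_def by auto
qed

lemma h_polyhedron_empty: "h_polyhedron n {}"
  unfolding h_polyhedron_def
  by (rule exI[of _ "{\<lambda>x. -1}"]) (auto intro: affine_form_const subring_Rats)

lemma h_polyhedron_point:
  assumes "v \<in> Rn n" "\<And>i. coord v i \<in> \<rat>"
  shows "h_polyhedron n {v}"
proof -
  define G where "G = (\<lambda>i x. coord x i - coord v i) ` {..<n} \<union> (\<lambda>i x. coord v i - coord x i) ` {..<n}"
  have "finite G" by (simp add: G_def)
  moreover have "G \<subseteq> affine_form \<rat> n"
    using assms(2) by (auto simp: G_def intro!: affine_form_diff affine_form_coord affine_form_const subring_Rats)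
  moreover have "{v} = {x \<in> Rn n. \<forall>g\<in>G. 0 \<le> g x}"
  proof -
    have "x = v" if "x \<in> Rn n" "\<forall>g\<in>G. 0 \<le> g x" for x
    proof (rule Rn_eqI[OF that(1) assms(1)])
      fix i assume "i < n"
      then have "0 \<le> coord x i - coord v i" "0 \<le> coord v i - coord x i"
        using that(2) unfolding G_def by force+
      then show "coord x i = coord v i" by simp
    qed
    then show ?thesis using assms(1) by (auto simp: G_def)
  qed
  ultimately show ?thesis unfolding h_polyhedron_def by blast
qed

lemma affine_form_ray:
  assumes "g \<in> affine_form A n"
  shows "g (w + s *\<^sub>R (x - v)) = g w + s * (g x - g v)"
proof -
  obtain a c where a: "g = (\<lambda>x. (\<Sum>i<n. a i * coord x i) + c)"
    using assms by (rule affine_formE)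
  show ?thesis
    by (simp add: a lookup_add lookup_minus sum.distrib sum_distrib_left sum_subtractf algebra_simps)
qed

text \<open>A point of the convex hull of \<open>v\<close> and \<open>W\<close> has the form \<open>x = (1 - t) v + t w\<close>, and for \<open>t > 0\<close> the conditions
  on \<open>w\<close> become affine in \<open>x\<close> and \<open>t\<close> after multiplication by \<open>t\<close>. For \<open>t = 0\<close> these conditions only say
  that \<open>x - v\<close> is a direction of recession of \<open>W\<close>; boundedness of \<open>W\<close> then forces \<open>x = v\<close>.\<close>

lemma hull_insert_as_projection:
  assumes W: "W = {x \<in> Rn n. \<forall>g\<in>G. 0 \<le> g x}" "G \<subseteq> affine_form \<rat> n"
    and ne: "W \<noteq> {}" and bd: "coord_bounded W" and v: "v \<in> Rn n" and x: "x \<in> Rn n"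
  shows "(\<exists>u w. 0 \<le> u \<and> u \<le> 1 \<and> w \<in> W \<and> x = (1 - u) *\<^sub>R v + u *\<^sub>R w) \<longleftrightarrow>
    (\<exists>t. 0 \<le> t \<and> t \<le> 1 \<and> (\<forall>g\<in>G. 0 \<le> (g x - g v) + t * g v))" (is "?lhs \<longleftrightarrow> ?rhs")
proof
  assume ?lhs
  then obtain u w where u: "0 \<le> u" "u \<le> 1" "w \<in> W" "x = (1 - u) *\<^sub>R v + u *\<^sub>R w" by blast
  have "0 \<le> (g x - g v) + u * g v" if g: "g \<in> G" for g
  proof -
    have "g x = (1 - u) * g v + u * g w"
      unfolding u(4) using W(2) g by (intro affine_funD[OF affine_fun_affine_form[of g "\<rat>" n]]) auto
    then have "(g x - g v) + u * g v = u * g w" by (simp add: algebra_simps)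
    then show ?thesis using u W(1) g by simp
  qed
  then show ?rhs using u by blast
next
  assume ?rhs
  then obtain t where t: "0 \<le> t" "t \<le> 1" "\<And>g. g \<in> G \<Longrightarrow> 0 \<le> (g x - g v) + t * g v" by blast
  show ?lhs
  proof (cases "t = 0")
    case True
    obtain w where w: "w \<in> W" using ne by blast
    \<comment> \<open>the direction \<open>x - v\<close> is a direction of recession of the bounded set \<open>W\<close>\<close>
    have ray: "w + s *\<^sub>R (x - v) \<in> W" if "s \<ge> 0" for s
    proof -
      have "0 \<le> g (w + s *\<^sub>R (x - v))" if g: "g \<in> G" for g
      proof -
        have "g w \<ge> 0" using w g W(1) by blast
        moreover have "s * (g x - g v) \<ge> 0" using t(3)[OF g] True \<open>s \<ge> 0\<close> by simp
        moreover have "g (w + s *\<^sub>R (x - v)) = g w + s * (g x - g v)"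
          using affine_form_ray g W(2) by blast
        ultimately show ?thesis by simp
      qed
      moreover have "w + s *\<^sub>R (x - v) \<in> Rn n"
        using w W(1) x v by (auto simp: Rn_iff lookup_add lookup_minus)
      ultimately show ?thesis using W(1) by blast
    qed
    obtain B where B: "\<forall>y\<in>W. \<forall>i. \<bar>coord y i\<bar> \<le> B" using coord_boundedE[OF bd] by blast
    have "coord x i = coord v i" for i
    proof (rule ccontr)
      assume ne: "coord x i \<noteq> coord v i"
      define d where "d = coord x i - coord v i"
      have d: "\<bar>d\<bar> > 0" using ne by (simp add: d_def)
      \<comment> \<open>far enough along the ray for the coordinate \<open>i\<close> to exceed the bound\<close>
      define s where "s = (2 * \<bar>B\<bar> + 1) / \<bar>d\<bar>"
      have "s \<ge> 0" using d by (simp add: s_def)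
      have "\<bar>coord w i + s * d\<bar> \<le> B" "\<bar>coord w i\<bar> \<le> B"
        using B[rule_format, OF ray[OF \<open>s \<ge> 0\<close>], of i] B[rule_format, OF w, of i]
        by (simp_all add: lookup_add lookup_minus d_def)
      moreover have "\<bar>s * d\<bar> = 2 * \<bar>B\<bar> + 1" using d by (simp add: s_def abs_mult)
      ultimately show False by linarith
    qed
    then have "x = v" by (intro poly_mapping_eqI)
    then show ?thesis using w by (intro exI[of _ 0] exI[of _ w]) simp
  next
    case False
    define w where "w = v + (1 / t) *\<^sub>R (x - v)"
    have "w \<in> Rn n" using x v by (simp add: w_def Rn_iff lookup_add lookup_minus)
    moreover have "0 \<le> g w" if g: "g \<in> G" for g
    proof -
      have "g w = g v + (1 / t) * (g x - g v)"
        unfolding w_def using affine_form_ray g W(2) by blast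
      also have "\<dots> = (1 / t) * ((g x - g v) + t * g v)" using False by (simp add: field_simps)
      finally show ?thesis using t(1) t(3)[OF g] by simp
    qed
    ultimately have "w \<in> W" using W(1) by blast
    moreover have "x = (1 - t) *\<^sub>R v + t *\<^sub>R w"
      using False by (simp add: w_def algebra_simps)
    ultimately show ?thesis using t by blast
  qed
qed

lemma rational_hull_h_polyhedron:
  assumes "finite V" "V \<subseteq> Rn n" "\<forall>v\<in>V. \<forall>i. coord v i \<in> \<rat>"
  shows "h_polyhedron n (convex hull V)"
  using assms
proof (induction V)
  case empty
  then show ?case by (simp add: h_polyhedron_empty)
next
  case (insert v V)
  show ?case
  proof (cases "V = {}")
    case True
    then show ?thesis using insert.prems by (simp add: h_polyhedron_point)
  next
    case False
    have v: "v \<in> Rn n" "\<And>i. coord v i \<in> \<rat>" using insert.prems by auto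
    obtain G where G: "finite G" "G \<subseteq> affine_form \<rat> n" "convex hull V = {x \<in> Rn n. \<forall>g\<in>G. 0 \<le> g x}"
      using insert unfolding h_polyhedron_def by auto
    have ne: "convex hull V \<noteq> {}" using False by simp
    have bd: "coord_bounded (convex hull V)" by (rule coord_bounded_hull[OF insert(1)])
    have gv: "g v \<in> \<rat>" if "g \<in> G" for g
      using G(2) that v(2) unfolding affine_form_def by (auto intro!: Rats_add Rats_sum Rats_mult)
    \<comment> \<open>the constraints \<open>0 \<le> t\<close> and \<open>t \<le> 1\<close>, followed by those of \<open>hull_insert_as_projection\<close>\<close>
    define K where "K = insert (\<lambda>x. 0, 1) (insert (\<lambda>x. 1, -1) ((\<lambda>g. (\<lambda>x. g x - g v, g v)) ` G))"
    have K: "finite K" "\<And>a c. (a, c) \<in> K \<Longrightarrow> a \<in> affine_form \<rat> n \<and> c \<in> \<rat>"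
      using G gv by (auto simp: K_def intro!: affine_form_diff affine_form_const subring_Rats)
    have "convex hull (insert v V) \<subseteq> Rn n"
      using insert.prems affine_imp_convex[OF affine_Rn] by (intro hull_minimal) auto
    then have "convex hull (insert v V) =
       {x \<in> Rn n. \<exists>u w. 0 \<le> u \<and> u \<le> 1 \<and> w \<in> convex hull V \<and> x = (1 - u) *\<^sub>R v + u *\<^sub>R w}"
      using False by (auto simp: convex_hull_insert_alt)
    also have "\<dots> = {x \<in> Rn n. \<exists>t. 0 \<le> t \<and> t \<le> 1 \<and> (\<forall>g\<in>G. 0 \<le> (g x - g v) + t * g v)}"
      using hull_insert_as_projection[OF G(3) G(2) ne bd v(1)] by blast
    also have "\<dots> = {x \<in> Rn n. \<exists>t. \<forall>k\<in>K. 0 \<le> fst k x + snd k * t}"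
      by (auto simp: K_def algebra_simps)
    finally show ?thesis using h_polyhedron_projection[OF K] by simp
  qed
qed

section \<open>Triangulating a cover\<close>

text \<open>Apply the barycentric subdivision to the arrangement of all inequalities of the members of \<open>\<F>\<close>
  together with those of a rational box that contains \<open>\<Union>\<F>\<close> in its interior. The box
  inequalities provide the assumption \<open>bounded_cells\<close>. A simplex lies in the closure of the cell of
  its top centre, and thus in every member of \<open>\<F>\<close> that contains this centre.\<close>

theorem rational_triangulation_of_cover:
  assumes fin: "finite \<F>" and hp: "\<And>S. S \<in> \<F> \<Longrightarrow> h_polyhedron n S" and bd: "coord_bounded (\<Union>\<F>)"
  obtains \<Delta> where "rational_triangulation n \<Delta> (\<Union>\<F>)" "\<And>T. T \<in> \<Delta> \<Longrightarrow> T \<noteq> {} \<Longrightarrow> \<exists>S\<in>\<F>. T \<subseteq> S"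
proof -
  have "\<forall>S\<in>\<F>. \<exists>G. finite G \<and> G \<subseteq> affine_form \<rat> n \<and> S = {x \<in> Rn n. \<forall>g\<in>G. 0 \<le> g x}"
    using hp unfolding h_polyhedron_def by simp
  then obtain H where "\<forall>S\<in>\<F>. finite (H S) \<and> H S \<subseteq> affine_form \<rat> n \<and> S = {x \<in> Rn n. \<forall>g\<in>H S. 0 \<le> g x}"
    by (rule bchoice[THEN exE])
  then have H: "\<And>S. S \<in> \<F> \<Longrightarrow> finite (H S) \<and> H S \<subseteq> affine_form \<rat> n \<and> S = {x \<in> Rn n. \<forall>g\<in>H S. 0 \<le> g x}"
    by simp
  obtain B0 where B0: "\<forall>x\<in>\<Union>\<F>. \<forall>i. \<bar>coord x i\<bar> \<le> B0" using coord_boundedE[OF bd] by blast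
  obtain B where B: "B \<in> \<rat>" "B0 < B" using Rats_dense_in_real[of B0 "B0 + 1"] by auto
  define G where "G = \<Union>(H ` \<F>) \<union> (\<lambda>i x. coord x i + B) ` {..<n} \<union> (\<lambda>i x. B - coord x i) ` {..<n}"
  define P where "P = \<Union>\<F>"
  \<comment> \<open>the choice depends only on the signs of \<open>x\<close>, so points of one cell have the same centre\<close>
  define b where "b x = (SOME q. q \<in> Rn n \<and> (\<forall>i. coord q i \<in> \<rat>) \<and> same_signs G q x)" for x
  have finG: "finite G" using fin H by (auto simp: G_def)
  have GQ: "G \<subseteq> affine_form \<rat> n"
    using H B by (auto simp: G_def intro!: affine_form_diff affine_form_add affine_form_coord affine_form_const subring_Rats)
  have b: "b x \<in> Rn n \<and> (\<forall>i. coord (b x) i \<in> \<rat>) \<and> same_signs G (b x) x" for x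
    unfolding b_def
    by (rule someI_ex[where P = "\<lambda>q. q \<in> Rn n \<and> (\<forall>i. coord q i \<in> \<rat>) \<and> same_signs G q x"])
      (use rational_point_same_signs[OF finG GQ, of x] in blast)
  have PR: "P \<subseteq> Rn n" using H unfolding P_def by blast
  have inS: "y \<in> S" if "S \<in> \<F>" "x \<in> S" "y \<in> Rn n" "below G y x" for x y S
  proof -
    have "0 \<le> g y" if g: "g \<in> H S" for g
    proof -
      have "0 \<le> g x" using H[OF \<open>S \<in> \<F>\<close>] \<open>x \<in> S\<close> g by blast
      moreover have "g \<in> G" using g \<open>S \<in> \<F>\<close> by (auto simp: G_def)
      ultimately show ?thesis using \<open>below G y x\<close> unfolding below_alt by (cases "g x = 0") auto
    qed
    then show ?thesis using H[OF \<open>S \<in> \<F>\<close>] that(3) by blast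
  qed
  interpret cell_complex G "Rn n" P b
  proof
    show "finite G" "affine (Rn n)" "P \<subseteq> Rn n" by (fact finG affine_Rn PR)+
    show "affine_fun g" if "g \<in> G" for g using GQ that affine_fun_affine_form by blast
    show down: "y \<in> P" if "x \<in> P" "y \<in> Rn n" "below G y x" for x y
      using inS that unfolding P_def by blast
    show "same_signs G (b x) x" for x using b by blast
    then show "b x \<in> P" if "x \<in> P" for x
      using down[OF that, of "b x"] b[of x] same_signs_imp_below[of G "b x" x] by blast
    show "b x = b y" if "same_signs G x y" for x y
    proof -
      have "same_signs G q x \<longleftrightarrow> same_signs G q y" for q
        using that by (simp add: same_signs_def)
      then show ?thesis by (simp add: b_def)
    qed
    show "\<exists>g\<in>G. 0 < g x \<and> g x < g y" if xy: "x \<in> P" "y \<in> P" "same_signs G x y" "x \<noteq> y" for x y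
    proof -
      obtain i where i: "i < n" "coord x i \<noteq> coord y i"
        using Rn_eqI[of x n y] xy PR by blast
      have bx: "\<bar>coord x i\<bar> < B" using B0 xy(1) B(2) unfolding P_def by (meson le_less_trans)
      show ?thesis
      proof (cases "coord x i < coord y i")
        case True
        have "(\<lambda>x. coord x i + B) \<in> G" using i by (auto simp: G_def)
        then show ?thesis by (rule bexI[rotated]) (use True bx in auto)
      next
        case False
        have "(\<lambda>x. B - coord x i) \<in> G" using i by (auto simp: G_def)
        then show ?thesis by (rule bexI[rotated]) (use False bx i in auto)
      qed
    qed
  qed
  have simplex: "rational_simplex n T" if "T \<in> barycentric" for T
  proof -
    obtain C where C: "is_chain C" "T = convex hull C" using \<open>T \<in> barycentric\<close> by (auto simp: barycentric_def)
    then have "C \<subseteq> b ` P" by (simp add: is_chain_def)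
    then have "C \<subseteq> Rn n" "\<forall>v\<in>C. \<forall>i. coord v i \<in> \<rat>" using b by auto
    then show ?thesis
      using C chain_finite[OF C(1)] chain_affine_independent[OF C(1)]
      unfolding rational_simplex_def by (intro exI[of _ C]) simp
  qed
  have "rational_triangulation n barycentric (\<Union>\<F>)"
    unfolding rational_triangulation_def
  proof (intro conjI ballI allI impI; (elim conjE)?)
    show "\<Union>barycentric = \<Union>\<F>" using barycentric_Union by (simp add: P_def)
  qed (fact barycentric_finite simplex barycentric_face barycentric_Int)+
  moreover have "\<exists>S\<in>\<F>. T \<subseteq> S" if T: "T \<in> barycentric" "T \<noteq> {}" for T
  proof -
    obtain p where p: "p \<in> P" "\<forall>x\<in>T. x \<in> P \<and> below G x p"
      by (rule barycentric_subset_cell[OF T])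
    then obtain S where S: "S \<in> \<F>" "p \<in> S" unfolding P_def by blast
    have "T \<subseteq> S"
    proof
      fix x assume "x \<in> T"
      then show "x \<in> S" using inS[OF S, of x] p(2) PR by blast
    qed
    then show ?thesis using S by blast
  qed
  ultimately show ?thesis by (rule that)
qed

section \<open>Finite unions of polyhedra given by inequalities\<close>

lemma h_polyhedron_subset_Rn: "h_polyhedron n S \<Longrightarrow> S \<subseteq> Rn n"
  unfolding h_polyhedron_def by blast

lemma h_polyhedronI:
  "\<lbrakk>finite G; G \<subseteq> affine_form \<rat> n; S = {x \<in> Rn n. \<forall>g\<in>G. 0 \<le> g x}\<rbrakk> \<Longrightarrow> h_polyhedron n S"
  unfolding h_polyhedron_def by (intro exI[of _ G]) simp

lemma h_polyhedronE:
  assumes "h_polyhedron n S"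
  obtains G where "finite G" "G \<subseteq> affine_form \<rat> n" "S = {x \<in> Rn n. \<forall>g\<in>G. 0 \<le> g x}"
  using assms unfolding h_polyhedron_def by (elim exE conjE)

lemma h_polyhedron_Rn: "h_polyhedron n (Rn n)"
  by (rule h_polyhedronI[of "{}"]) auto

lemma h_polyhedron_Int:
  assumes "h_polyhedron n S" "h_polyhedron n T" shows "h_polyhedron n (S \<inter> T)"
proof -
  obtain G where G: "finite G" "G \<subseteq> affine_form \<rat> n" "S = {x \<in> Rn n. \<forall>g\<in>G. 0 \<le> g x}"
    using assms(1) by (rule h_polyhedronE)
  obtain H where H: "finite H" "H \<subseteq> affine_form \<rat> n" "T = {x \<in> Rn n. \<forall>g\<in>H. 0 \<le> g x}"
    using assms(2) by (rule h_polyhedronE)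
  show ?thesis by (rule h_polyhedronI[of "G \<union> H"]) (use G H in auto)
qed

lemma h_polyhedron_preimage:
  assumes T: "h_polyhedron m T" and f: "\<And>i. i < m \<Longrightarrow> (\<lambda>x. coord (f x) i) \<in> affine_form \<rat> n" "\<And>x. f x \<in> Rn m"
  shows "h_polyhedron n {x \<in> Rn n. f x \<in> T}"
proof -
  obtain G where G: "finite G" "G \<subseteq> affine_form \<rat> m" "T = {x \<in> Rn m. \<forall>g\<in>G. 0 \<le> g x}"
    using T by (rule h_polyhedronE)
  have "g \<circ> f \<in> affine_form \<rat> n" if "g \<in> G" for g
    using affine_form_compose[OF subring_Rats, of g m f n] G(2) f(1) that by (auto simp: comp_def)
  then show ?thesis by (intro h_polyhedronI[of "(\<lambda>g. g \<circ> f) ` G"]) (use G f(2) in auto)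
qed

lemma h_polyhedron_equation:
  assumes "k \<in> affine_form \<rat> n" "l \<in> affine_form \<rat> n"
  shows "h_polyhedron n {x \<in> Rn n. k x = l x}"
proof (rule h_polyhedronI[of "{\<lambda>x. k x - l x, \<lambda>x. l x - k x}"])
  show "{\<lambda>x. k x - l x, \<lambda>x. l x - k x} \<subseteq> affine_form \<rat> n"
    using affine_form_diff[OF subring_Rats assms] affine_form_diff[OF subring_Rats assms(2,1)] by simp
qed auto

definition polyhedral :: "nat \<Rightarrow> pt set \<Rightarrow> bool" where
  "polyhedral n P \<longleftrightarrow> (\<exists>\<F>. finite \<F> \<and> (\<forall>S\<in>\<F>. h_polyhedron n S) \<and> P = \<Union>\<F>)"

lemma polyhedralI: "\<lbrakk>finite \<F>; \<And>S. S \<in> \<F> \<Longrightarrow> h_polyhedron n S; P = \<Union>\<F>\<rbrakk> \<Longrightarrow> polyhedral n P"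
  unfolding polyhedral_def by (intro exI[of _ \<F>]) simp

lemma polyhedralE:
  assumes "polyhedral n P"
  obtains \<F> where "finite \<F>" "\<forall>S\<in>\<F>. h_polyhedron n S" "P = \<Union>\<F>"
  using assms unfolding polyhedral_def by (elim exE conjE)

lemma h_polyhedron_imp_polyhedral: "h_polyhedron n S \<Longrightarrow> polyhedral n S"
  by (rule polyhedralI[of "{S}"]) auto

lemma polyhedral_subset_Rn: "polyhedral n P \<Longrightarrow> P \<subseteq> Rn n"
  by (elim polyhedralE) (use h_polyhedron_subset_Rn in blast)

lemma polyhedral_UN:
  assumes "finite I" "\<And>i. i \<in> I \<Longrightarrow> h_polyhedron n (A i)" shows "polyhedral n (\<Union>i\<in>I. A i)"
  by (rule polyhedralI[of "A ` I"]) (use assms in auto)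

lemma polyhedral_Int:
  assumes "polyhedral n P" "polyhedral n Q" shows "polyhedral n (P \<inter> Q)"
proof -
  obtain \<F> where F: "finite \<F>" "\<forall>S\<in>\<F>. h_polyhedron n S" "P = \<Union>\<F>"
    using assms(1) by (rule polyhedralE)
  obtain \<G> where G: "finite \<G>" "\<forall>S\<in>\<G>. h_polyhedron n S" "Q = \<Union>\<G>"
    using assms(2) by (rule polyhedralE)
  have "P \<inter> Q = (\<Union>p\<in>\<F> \<times> \<G>. fst p \<inter> snd p)" using F(3) G(3) by auto
  moreover have "polyhedral n (\<Union>p\<in>\<F> \<times> \<G>. fst p \<inter> snd p)"
    using F G by (intro polyhedral_UN h_polyhedron_Int) auto
  ultimately show ?thesis by simp
qed

lemma polyhedral_INT:
  assumes "finite I" "\<And>i. i \<in> I \<Longrightarrow> polyhedral n {x \<in> Rn n. Q i x}"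
  shows "polyhedral n {x \<in> Rn n. \<forall>i\<in>I. Q i x}"
  using assms
proof (induction I)
  case empty
  then show ?case by (simp add: h_polyhedron_imp_polyhedral h_polyhedron_Rn)
next
  case (insert i I)
  have "{x \<in> Rn n. \<forall>j\<in>insert i I. Q j x} = {x \<in> Rn n. Q i x} \<inter> {x \<in> Rn n. \<forall>j\<in>I. Q j x}" by auto
  then show ?case using polyhedral_Int insert by simp
qed

lemma polyhedral_preimage:
  assumes Q: "polyhedral m Q" and f: "\<And>i. i < m \<Longrightarrow> (\<lambda>x. coord (f x) i) \<in> affine_form \<rat> n" "\<And>x. f x \<in> Rn m"
  shows "polyhedral n {x \<in> Rn n. f x \<in> Q}"
proof -
  obtain \<F> where F: "finite \<F>" "\<forall>S\<in>\<F>. h_polyhedron m S" "Q = \<Union>\<F>"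
    using Q by (rule polyhedralE)
  have "{x \<in> Rn n. f x \<in> Q} = (\<Union>S\<in>\<F>. {x \<in> Rn n. f x \<in> S})" using F by auto
  moreover have "polyhedral n (\<Union>S\<in>\<F>. {x \<in> Rn n. f x \<in> S})"
    using F f by (intro polyhedral_UN h_polyhedron_preimage) auto
  ultimately show ?thesis by simp
qed

lemma rational_simplex_h_polyhedron:
  assumes "rational_simplex n S" shows "h_polyhedron n S" "coord_bounded S"
proof -
  obtain V where "finite V" "V \<subseteq> Rn n" "\<forall>v\<in>V. \<forall>i. coord v i \<in> \<rat>" "S = convex hull V"
    using assms unfolding rational_simplex_def by (elim exE conjE)
  then show "h_polyhedron n S" "coord_bounded S"
    using rational_hull_h_polyhedron coord_bounded_hull by auto
qed

text \<open>The passage from simplexes to inequalities is \<open>rational_simplex_h_polyhedron\<close>, the converse is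
  the existence of a triangulation.\<close>

lemma rational_polyhedron_iff:
  "rational_polyhedron n P \<longleftrightarrow> polyhedral n P \<and> coord_bounded P"
proof
  assume "rational_polyhedron n P"
  then obtain \<F> where F: "finite \<F>" "\<forall>S\<in>\<F>. rational_simplex n S" "P = \<Union>\<F>"
    unfolding rational_polyhedron_def by (elim exE conjE)
  have "polyhedral n P" by (rule polyhedralI[OF F(1) _ F(3)]) (use F(2) rational_simplex_h_polyhedron in simp)
  moreover have "coord_bounded P"
    unfolding F(3) by (rule coord_bounded_Union[OF F(1)]) (use F(2) rational_simplex_h_polyhedron(2)[of n] in blast)
  ultimately show "polyhedral n P \<and> coord_bounded P" ..
next
  assume a: "polyhedral n P \<and> coord_bounded P"
  then obtain \<F> where F: "finite \<F>" "\<forall>S\<in>\<F>. h_polyhedron n S" "P = \<Union>\<F>"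
    using polyhedralE by metis
  obtain \<Delta> where "rational_triangulation n \<Delta> (\<Union>\<F>)"
    by (rule rational_triangulation_of_cover[of \<F> n]) (use F a in simp_all)
  then show "rational_polyhedron n P"
    unfolding rational_triangulation_def rational_polyhedron_def F(3) by (intro exI[of _ \<Delta>]) simp
qed

section \<open>Piecewise integral affine functions\<close>

definition Z_affine_on :: "nat \<Rightarrow> pt set \<Rightarrow> (pt \<Rightarrow> real) \<Rightarrow> bool" where
  "Z_affine_on n S h \<longleftrightarrow> (\<exists>k\<in>affine_form \<int> n. \<forall>x\<in>S. h x = k x)"

lemma Z_affine_on_subset: "Z_affine_on n S h \<Longrightarrow> T \<subseteq> S \<Longrightarrow> Z_affine_on n T h"
  unfolding Z_affine_on_def by blast

definition piecewise_Z_affine :: "nat \<Rightarrow> pt set \<Rightarrow> (pt \<Rightarrow> real) \<Rightarrow> bool" where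
  "piecewise_Z_affine n P h \<longleftrightarrow>
     (\<exists>\<F>. finite \<F> \<and> (\<forall>S\<in>\<F>. h_polyhedron n S \<and> Z_affine_on n S h) \<and> P = \<Union>\<F>)"

lemma piecewise_Z_affineI:
  "\<lbrakk>finite \<F>; \<And>S. S \<in> \<F> \<Longrightarrow> h_polyhedron n S; \<And>S. S \<in> \<F> \<Longrightarrow> Z_affine_on n S h; P = \<Union>\<F>\<rbrakk>
    \<Longrightarrow> piecewise_Z_affine n P h"
  unfolding piecewise_Z_affine_def by (intro exI[of _ \<F>]) simp

lemma piecewise_Z_affineE:
  assumes "piecewise_Z_affine n P h"
  obtains \<F> where "finite \<F>" "\<forall>S\<in>\<F>. h_polyhedron n S \<and> Z_affine_on n S h" "P = \<Union>\<F>"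
  using assms unfolding piecewise_Z_affine_def by (elim exE conjE)

lemma piecewise_Z_affineI_affine:
  assumes "polyhedral n P" "Z_affine_on n P h" shows "piecewise_Z_affine n P h"
proof -
  obtain \<F> where F: "finite \<F>" "\<forall>S\<in>\<F>. h_polyhedron n S" "P = \<Union>\<F>"
    using assms(1) by (rule polyhedralE)
  show ?thesis
    by (rule piecewise_Z_affineI[OF F(1) _ _ F(3)])
      (use F(2) Z_affine_on_subset[OF assms(2)] in \<open>auto simp: F(3)\<close>)
qed

lemma piecewise_Z_affine_cong:
  assumes "piecewise_Z_affine n P h" "\<And>x. x \<in> P \<Longrightarrow> h' x = h x"
  shows "piecewise_Z_affine n P h'"
proof -
  obtain \<F> where F: "finite \<F>" "\<forall>S\<in>\<F>. h_polyhedron n S \<and> Z_affine_on n S h" "P = \<Union>\<F>"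
    using assms(1) by (rule piecewise_Z_affineE)
  have "Z_affine_on n S h'" if S: "S \<in> \<F>" for S
  proof -
    have "\<forall>x\<in>S. h' x = h x" using assms(2) S F(3) by auto
    then show ?thesis using F(2) S unfolding Z_affine_on_def by (metis (no_types))
  qed
  then show ?thesis using F by (intro piecewise_Z_affineI[of \<F>]) auto
qed

text \<open>Pairwise intersections of the pieces of two functions are pieces for both.\<close>

lemma common_Z_affine_pieces:
  assumes "finite I" "polyhedral n P" "\<And>i. i \<in> I \<Longrightarrow> piecewise_Z_affine n P (h i)"
  shows "\<exists>\<F>. finite \<F> \<and> (\<forall>S\<in>\<F>. h_polyhedron n S \<and> (\<forall>i\<in>I. Z_affine_on n S (h i))) \<and> P = \<Union>\<F>"
  using assms(1,3)
proof (induction I)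
  case empty
  show ?case using assms(2) unfolding polyhedral_def by simp
next
  case (insert i I)
  then obtain \<F> where F: "finite \<F>" "\<forall>S\<in>\<F>. h_polyhedron n S \<and> (\<forall>i\<in>I. Z_affine_on n S (h i))" "P = \<Union>\<F>"
    by auto
  have "piecewise_Z_affine n P (h i)" using insert by simp
  then obtain \<G> where G: "finite \<G>" "\<forall>S\<in>\<G>. h_polyhedron n S \<and> Z_affine_on n S (h i)" "P = \<Union>\<G>"
    by (rule piecewise_Z_affineE)
  define \<H> where "\<H> = (\<lambda>p. fst p \<inter> snd p) ` (\<F> \<times> \<G>)"
  have "finite \<H>" using F G by (simp add: \<H>_def)
  moreover have "h_polyhedron n S \<and> (\<forall>j\<in>insert i I. Z_affine_on n S (h j))" if "S \<in> \<H>" for S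
  proof -
    obtain A B where AB: "A \<in> \<F>" "B \<in> \<G>" "S = A \<inter> B" using \<open>S \<in> \<H>\<close> by (auto simp: \<H>_def)
    have "Z_affine_on n S (h j)" if "j \<in> I" for j
      using Z_affine_on_subset[of n A "h j" S] F(2) AB that by auto
    moreover have "Z_affine_on n S (h i)" using Z_affine_on_subset[of n B "h i" S] G(2) AB by auto
    moreover have "h_polyhedron n S" using h_polyhedron_Int F G AB by auto
    ultimately show ?thesis by auto
  qed
  moreover have "P = \<Union>\<H>"
  proof
    show "\<Union>\<H> \<subseteq> P" using F(3) by (auto simp: \<H>_def)
    show "P \<subseteq> \<Union>\<H>"
    proof
      fix x assume "x \<in> P"
      then have "x \<in> \<Union>\<F>" "x \<in> \<Union>\<G>" using F(3) G(3) by simp_all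
      then obtain A B where "A \<in> \<F>" "B \<in> \<G>" "x \<in> A" "x \<in> B" by (elim UnionE)
      then show "x \<in> \<Union>\<H>" by (force simp: \<H>_def)
    qed
  qed
  ultimately show ?case by (intro exI[of _ \<H>]) simp
qed

text \<open>An integral affine map on \<open>S\<close> is the restriction of one that is defined everywhere, which can be
  used to form preimages.\<close>

lemma Z_affine_extension:
  assumes "\<And>i. i < m \<Longrightarrow> Z_affine_on n S (\<lambda>x. coord (f x) i)" "\<And>x. x \<in> S \<Longrightarrow> f x \<in> Rn m"
  shows "\<exists>\<phi>. (\<forall>i<m. (\<lambda>x. coord (\<phi> x) i) \<in> affine_form \<int> n) \<and> (\<forall>x. \<phi> x \<in> Rn m) \<and> (\<forall>x\<in>S. f x = \<phi> x)"
proof -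
  have "\<forall>i\<in>{..<m}. \<exists>k. k \<in> affine_form \<int> n \<and> (\<forall>x\<in>S. coord (f x) i = k x)"
    using assms(1) unfolding Z_affine_on_def by auto
  then obtain k where k: "\<forall>i\<in>{..<m}. k i \<in> affine_form \<int> n \<and> (\<forall>x\<in>S. coord (f x) i = k i x)"
    by (rule bchoice[THEN exE])
  define \<phi> where "\<phi> x = pt_of m (\<lambda>i. k i x)" for x
  have "(\<lambda>x. coord (\<phi> x) i) \<in> affine_form \<int> n" if "i < m" for i
    using k that by (simp add: \<phi>_def)
  moreover have "\<phi> x \<in> Rn m" for x by (simp add: \<phi>_def)
  moreover have "f x = \<phi> x" if "x \<in> S" for x
    by (rule Rn_eqI[OF assms(2)[OF that]]) (use k that in \<open>simp_all add: \<phi>_def\<close>)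
  ultimately show ?thesis by (intro exI[of _ \<phi>]) simp
qed

lemma affine_form_Ints_Rats: "k \<in> affine_form \<int> n \<Longrightarrow> k \<in> affine_form \<rat> n"
  using affine_form_mono[of \<int> \<rat> n] Ints_subset_Rats by blast

text \<open>If \<open>f\<close> agrees on \<open>S\<close> with the affine map \<open>\<phi>\<close>, and \<open>g\<close> is affine on \<open>T\<close>, then \<open>g\<close> after \<open>f\<close> is affine on
  \<open>S \<inter> \<phi>\<^sup>-\<^sup>1(T)\<close>. It is here that covers by preimages are more convenient than triangulations.\<close>

lemma piecewise_Z_affine_compose:
  assumes g: "piecewise_Z_affine m Q g" and P: "polyhedral n P"
    and f: "\<And>i. i < m \<Longrightarrow> piecewise_Z_affine n P (\<lambda>x. coord (f x) i)" "\<And>x. x \<in> P \<Longrightarrow> f x \<in> Q"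
  shows "piecewise_Z_affine n P (\<lambda>x. g (f x))"
proof -
  obtain \<G> where G: "finite \<G>" "\<forall>T\<in>\<G>. h_polyhedron m T \<and> Z_affine_on m T g" "Q = \<Union>\<G>"
    using g by (rule piecewise_Z_affineE)
  have QR: "Q \<subseteq> Rn m" using G h_polyhedron_subset_Rn by auto
  obtain \<F> where F: "finite \<F>" "P = \<Union>\<F>"
      "\<forall>S\<in>\<F>. h_polyhedron n S \<and> (\<forall>i\<in>{..<m}. Z_affine_on n S (\<lambda>x. coord (f x) i))"
    using common_Z_affine_pieces[OF finite_lessThan[of m] P, of "\<lambda>i x. coord (f x) i"] f(1) by auto
  have "\<forall>S\<in>\<F>. \<exists>\<phi>. (\<forall>i<m. (\<lambda>x. coord (\<phi> x) i) \<in> affine_form \<int> n) \<and> (\<forall>x. \<phi> x \<in> Rn m) \<and> (\<forall>x\<in>S. f x = \<phi> x)"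
  proof
    fix S assume S: "S \<in> \<F>"
    show "\<exists>\<phi>. (\<forall>i<m. (\<lambda>x. coord (\<phi> x) i) \<in> affine_form \<int> n) \<and> (\<forall>x. \<phi> x \<in> Rn m) \<and> (\<forall>x\<in>S. f x = \<phi> x)"
      by (rule Z_affine_extension) (use F S f(2) QR in auto)
  qed
  then obtain \<phi> where phi: "\<forall>S\<in>\<F>. (\<forall>i<m. (\<lambda>x. coord (\<phi> S x) i) \<in> affine_form \<int> n) \<and>
      (\<forall>x. \<phi> S x \<in> Rn m) \<and> (\<forall>x\<in>S. f x = \<phi> S x)"
    by (rule bchoice[THEN exE])
  define piece where "piece S T = S \<inter> {x \<in> Rn n. \<phi> S x \<in> T}" for S T
  show ?thesis
  proof (rule piecewise_Z_affineI[of "(\<lambda>p. piece (fst p) (snd p)) ` (\<F> \<times> \<G>)"])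
    show "finite ((\<lambda>p. piece (fst p) (snd p)) ` (\<F> \<times> \<G>))" using F G by simp
    fix S' assume "S' \<in> (\<lambda>p. piece (fst p) (snd p)) ` (\<F> \<times> \<G>)"
    then obtain S T where ST: "S \<in> \<F>" "T \<in> \<G>" "S' = piece S T" by auto
    have phiS: "\<And>i. i < m \<Longrightarrow> (\<lambda>x. coord (\<phi> S x) i) \<in> affine_form \<int> n" "\<And>x. \<phi> S x \<in> Rn m"
        "\<And>x. x \<in> S \<Longrightarrow> f x = \<phi> S x" using phi ST(1) by auto
    show "h_polyhedron n S'"
      unfolding ST(3) piece_def
      by (intro h_polyhedron_Int h_polyhedron_preimage[of m] affine_form_Ints_Rats phiS) (use F G ST in auto)
    obtain k where k: "k \<in> affine_form \<int> m" "\<forall>x\<in>T. g x = k x"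
      using G ST unfolding Z_affine_on_def by auto
    have "(\<lambda>x. k (\<phi> S x)) \<in> affine_form \<int> n"
      by (rule affine_form_compose[OF subring_Ints k(1) phiS(1)])
    moreover have "\<forall>x\<in>S'. g (f x) = k (\<phi> S x)"
      using k(2) phiS(3) by (simp add: ST(3) piece_def)
    ultimately show "Z_affine_on n S' (\<lambda>x. g (f x))"
      unfolding Z_affine_on_def by (intro bexI[of _ "\<lambda>x. k (\<phi> S x)"])
  next
    show "P = \<Union>((\<lambda>p. piece (fst p) (snd p)) ` (\<F> \<times> \<G>))"
    proof
      show "\<Union>((\<lambda>p. piece (fst p) (snd p)) ` (\<F> \<times> \<G>)) \<subseteq> P" using F by (auto simp: piece_def)
      show "P \<subseteq> \<Union>((\<lambda>p. piece (fst p) (snd p)) ` (\<F> \<times> \<G>))"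
      proof
        fix x assume x: "x \<in> P"
        then obtain S T where ST: "S \<in> \<F>" "T \<in> \<G>" "x \<in> S" "f x \<in> T" using F(2) f(2) G(3) by blast
        then have "\<phi> S x \<in> T" using phi by auto
        moreover have "x \<in> Rn n" using x polyhedral_subset_Rn[OF P] by blast
        ultimately have "x \<in> piece S T" using ST by (simp add: piece_def)
        then show "x \<in> \<Union>((\<lambda>p. piece (fst p) (snd p)) ` (\<F> \<times> \<G>))" using ST by force
      qed
    qed
  qed
qed

lemma polyhedral_equalizer:
  assumes h: "piecewise_Z_affine n P h" and k: "k \<in> affine_form \<int> n"
  shows "polyhedral n {x \<in> P. h x = k x}"
proof -
  obtain \<F> where F: "finite \<F>" "\<forall>S\<in>\<F>. h_polyhedron n S \<and> Z_affine_on n S h" "P = \<Union>\<F>"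
    using h by (rule piecewise_Z_affineE)
  have "{x \<in> P. h x = k x} = (\<Union>S\<in>\<F>. {x \<in> S. h x = k x})" using F(3) by auto
  moreover have "h_polyhedron n {x \<in> S. h x = k x}" if S: "S \<in> \<F>" for S
  proof -
    obtain l where l: "l \<in> affine_form \<int> n" "\<forall>x\<in>S. h x = l x"
      using F(2) S unfolding Z_affine_on_def by auto
    have hS: "h_polyhedron n S" using F(2) S by simp
    have "{x \<in> S. h x = k x} = S \<inter> {x \<in> Rn n. l x = k x}"
      using l h_polyhedron_subset_Rn[OF hS] by auto
    then show ?thesis
      using h_polyhedron_Int[OF hS h_polyhedron_equation] l k affine_form_Ints_Rats by simp
  qed
  ultimately show ?thesis using polyhedral_UN[OF F(1)] by simp
qed

text \<open>A triangulation is a special cover. Conversely, a triangulation that refines a common cover for all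
  coordinates exists by \<open>rational_triangulation_of_cover\<close>.\<close>

lemma Z_map_iff:
  assumes P: "rational_polyhedron n P"
  shows "Z_map n P m \<eta> \<longleftrightarrow> \<eta> \<in> P \<rightarrow> Rn m \<and> (\<forall>i<m. piecewise_Z_affine n P (\<lambda>x. coord (\<eta> x) i))"
proof (intro iffI conjI allI impI)
  assume Z: "Z_map n P m \<eta>"
  then show "\<eta> \<in> P \<rightarrow> Rn m" by (simp add: Z_map_def)
  obtain \<Delta> where D: "rational_triangulation n \<Delta> P"
     "\<forall>T\<in>\<Delta>. \<exists>(M :: nat \<Rightarrow> nat \<Rightarrow> int) (b :: nat \<Rightarrow> int). \<forall>x\<in>T. \<forall>i<m.
          coord (\<eta> x) i = (\<Sum>j<n. of_int (M i j) * coord x j) + of_int (b i)"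
    using Z unfolding Z_map_def by (elim exE conjE)
  fix i assume i: "i < m"
  show "piecewise_Z_affine n P (\<lambda>x. coord (\<eta> x) i)"
  proof (rule piecewise_Z_affineI[of \<Delta>])
    show "finite \<Delta>" "P = \<Union>\<Delta>" using D(1) by (simp_all add: rational_triangulation_def)
    fix T assume T: "T \<in> \<Delta>"
    show "h_polyhedron n T"
      using D(1) T rational_simplex_h_polyhedron by (simp add: rational_triangulation_def)
    obtain M :: "nat \<Rightarrow> nat \<Rightarrow> int" and b :: "nat \<Rightarrow> int" where Mb: "\<forall>x\<in>T. \<forall>i<m.
          coord (\<eta> x) i = (\<Sum>j<n. of_int (M i j) * coord x j) + of_int (b i)"
      using bspec[OF D(2) T] by (elim exE)
    have "(\<lambda>x. (\<Sum>j<n. of_int (M i j) * coord x j) + of_int (b i)) \<in> affine_form \<int> n"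
      by (rule affine_formI) simp_all
    then show "Z_affine_on n T (\<lambda>x. coord (\<eta> x) i)"
      unfolding Z_affine_on_def by (rule bexI[rotated]) (use Mb i in simp)
  qed
next
  assume r: "\<eta> \<in> P \<rightarrow> Rn m \<and> (\<forall>i<m. piecewise_Z_affine n P (\<lambda>x. coord (\<eta> x) i))"
  have P': "polyhedral n P" "coord_bounded P" using P by (simp_all add: rational_polyhedron_iff)
  obtain \<F> where F: "finite \<F>" "P = \<Union>\<F>"
      "\<forall>S\<in>\<F>. h_polyhedron n S \<and> (\<forall>i\<in>{..<m}. Z_affine_on n S (\<lambda>x. coord (\<eta> x) i))"
    using common_Z_affine_pieces[OF finite_lessThan[of m] P'(1), of "\<lambda>i x. coord (\<eta> x) i"] r by auto
  obtain \<Delta> where D: "rational_triangulation n \<Delta> P" "\<And>T. T \<in> \<Delta> \<Longrightarrow> T \<noteq> {} \<Longrightarrow> \<exists>S\<in>\<F>. T \<subseteq> S"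
    by (rule rational_triangulation_of_cover[of \<F> n]) (use F P'(2) in simp_all)
  have "\<exists>(M :: nat \<Rightarrow> nat \<Rightarrow> int) (b :: nat \<Rightarrow> int). \<forall>x\<in>T. \<forall>i<m.
          coord (\<eta> x) i = (\<Sum>j<n. of_int (M i j) * coord x j) + of_int (b i)" if T: "T \<in> \<Delta>" for T
  \<comment> \<open>the empty simplex need not be contained in a member of \<open>\<F>\<close>, as \<open>\<F>\<close> can be empty\<close>
  proof (cases "T = {}")
    case False
    then obtain S where S: "S \<in> \<F>" "T \<subseteq> S" using D(2) T by blast
    have "\<forall>i\<in>{..<m}. \<exists>Mb :: (nat \<Rightarrow> int) \<times> int. \<forall>x\<in>T.
          coord (\<eta> x) i = (\<Sum>j<n. of_int (fst Mb j) * coord x j) + of_int (snd Mb)"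
    proof
      fix i assume "i \<in> {..<m}"
      then have "Z_affine_on n T (\<lambda>x. coord (\<eta> x) i)" using F(3) S Z_affine_on_subset by blast
      then obtain k where k: "k \<in> affine_form \<int> n" "\<forall>x\<in>T. coord (\<eta> x) i = k x"
        unfolding Z_affine_on_def by (elim bexE)
      obtain a c where a: "\<forall>i. a i \<in> \<int>" "c \<in> \<int>" "k = (\<lambda>x. (\<Sum>i<n. a i * coord x i) + c)"
        using k(1) by (rule affine_formE)
      show "\<exists>Mb :: (nat \<Rightarrow> int) \<times> int. \<forall>x\<in>T.
          coord (\<eta> x) i = (\<Sum>j<n. of_int (fst Mb j) * coord x j) + of_int (snd Mb)"
        by (rule exI[of _ "(\<lambda>j. \<lfloor>a j\<rfloor>, \<lfloor>c\<rfloor>)"]) (use k(2) a in simp)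
    qed
    then obtain Mb :: "nat \<Rightarrow> (nat \<Rightarrow> int) \<times> int" where Mb: "\<forall>i\<in>{..<m}. \<forall>x\<in>T.
          coord (\<eta> x) i = (\<Sum>j<n. of_int (fst (Mb i) j) * coord x j) + of_int (snd (Mb i))"
      by (rule bchoice[THEN exE])
    show ?thesis
      by (rule exI[of _ "\<lambda>i. fst (Mb i)"], rule exI[of _ "\<lambda>i. snd (Mb i)"]) (use Mb in simp)
  qed simp
  then show "Z_map n P m \<eta>"
    unfolding Z_map_def using r D(1) by (intro conjI exI[of _ \<Delta>]) auto
qed

section \<open>The category of rational polyhedra\<close>

definition is_Z_map :: "pobj \<Rightarrow> pobj \<Rightarrow> (pt \<Rightarrow> pt) \<Rightarrow> bool" where
  "is_Z_map A B \<eta> \<longleftrightarrow> A \<in> PZ_objects \<and> B \<in> PZ_objects \<and> \<eta> \<in> extensional (snd A) \<and>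
     \<eta> ` snd A \<subseteq> snd B \<and> (\<forall>i<fst B. piecewise_Z_affine (fst A) (snd A) (\<lambda>x. coord (\<eta> x) i))"

lemma PZ_objects_iff: "A \<in> PZ_objects \<longleftrightarrow> 1 \<le> fst A \<and> polyhedral (fst A) (snd A) \<and> coord_bounded (snd A)"
  by (auto simp: PZ_objects_def rational_polyhedron_iff)

lemma PZ_object_subset_Rn: "A \<in> PZ_objects \<Longrightarrow> snd A \<subseteq> Rn (fst A)"
  by (simp add: PZ_objects_iff polyhedral_subset_Rn)

lemma is_Z_map_cod: "is_Z_map A B \<eta> \<Longrightarrow> x \<in> snd A \<Longrightarrow> \<eta> x \<in> snd B"
  unfolding is_Z_map_def by auto

lemma PZ_arrows_iff: "(A, \<eta>, B) \<in> PZ_arrows \<longleftrightarrow> is_Z_map A B \<eta>"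
proof -
  have *: "Z_map (fst A) (snd A) (fst B) \<eta> \<longleftrightarrow>
      (\<forall>i<fst B. piecewise_Z_affine (fst A) (snd A) (\<lambda>x. coord (\<eta> x) i))"
    if "A \<in> PZ_objects" "B \<in> PZ_objects" "\<eta> ` snd A \<subseteq> snd B"
  proof -
    have "rational_polyhedron (fst A) (snd A)" using that(1) by (auto simp: PZ_objects_def)
    moreover have "\<eta> \<in> snd A \<rightarrow> Rn (fst B)" using that(3) PZ_object_subset_Rn[OF that(2)] by auto
    ultimately show ?thesis by (simp add: Z_map_iff)
  qed
  have "(A, \<eta>, B) \<in> PZ_arrows \<longleftrightarrow> A \<in> PZ_objects \<and> B \<in> PZ_objects \<and> \<eta> \<in> extensional (snd A) \<and>
      Z_map (fst A) (snd A) (fst B) \<eta> \<and> \<eta> ` snd A \<subseteq> snd B"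
    by (cases A; cases B) (simp add: PZ_arrows_def)
  then show ?thesis unfolding is_Z_map_def using * by blast
qed

lemma PZ_simps [simp]:
  "Ob PZ = PZ_objects" "Ar PZ = PZ_arrows" "src PZ (A, \<eta>, B) = A" "tgt PZ (A, \<eta>, B) = B"
  "idn PZ A = (A, restrict (\<lambda>x. x) (snd A), A)"
  "cmp PZ (B', \<theta>, C) (A, \<eta>, B) = (A, compose (snd A) \<theta> \<eta>, C)"
  by (simp_all add: PZ_def)

lemma hom_set_PZ: "f \<in> hom_set PZ A B \<longleftrightarrow> (\<exists>\<eta>. f = (A, \<eta>, B) \<and> is_Z_map A B \<eta>)"
proof -
  obtain A' \<eta> B' where f: "f = (A', \<eta>, B')" by (cases f)
  show ?thesis unfolding f by (auto simp: hom_set_def PZ_arrows_iff)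
qed

lemma hom_set_PZE:
  assumes "f \<in> hom_set PZ A B" obtains \<eta> where "f = (A, \<eta>, B)" "is_Z_map A B \<eta>"
  using assms unfolding hom_set_PZ by (elim exE conjE)

lemma is_Z_map_id:
  assumes "A \<in> PZ_objects" shows "is_Z_map A A (restrict (\<lambda>x. x) (snd A))"
proof -
  have "Z_affine_on (fst A) (snd A) (\<lambda>x. coord (restrict (\<lambda>x. x) (snd A) x) i)" if "i < fst A" for i
    unfolding Z_affine_on_def
    by (rule bexI[OF _ affine_form_coord[OF subring_Ints that]]) simp
  then have "piecewise_Z_affine (fst A) (snd A) (\<lambda>x. coord (restrict (\<lambda>x. x) (snd A) x) i)" if "i < fst A" for i
    using piecewise_Z_affineI_affine assms that by (simp add: PZ_objects_iff)
  then show ?thesis unfolding is_Z_map_def using assms by auto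
qed

lemma is_Z_map_compose:
  assumes f: "is_Z_map A B \<eta>" and g: "is_Z_map B C \<theta>"
  shows "is_Z_map A C (compose (snd A) \<theta> \<eta>)"
proof -
  have "piecewise_Z_affine (fst A) (snd A) (\<lambda>x. coord (compose (snd A) \<theta> \<eta> x) i)" if i: "i < fst C" for i
  proof (rule piecewise_Z_affine_cong)
    show "piecewise_Z_affine (fst A) (snd A) (\<lambda>x. coord (\<theta> (\<eta> x)) i)"
    proof (rule piecewise_Z_affine_compose[of "fst B" "snd B" "\<lambda>y. coord (\<theta> y) i" "fst A" "snd A" \<eta>])
      show "piecewise_Z_affine (fst B) (snd B) (\<lambda>y. coord (\<theta> y) i)" using g i by (simp add: is_Z_map_def)
      show "polyhedral (fst A) (snd A)" using f by (simp add: is_Z_map_def PZ_objects_iff)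
    qed (use f in \<open>auto simp: is_Z_map_def\<close>)
  qed (simp add: compose_eq)
  moreover have "compose (snd A) \<theta> \<eta> ` snd A \<subseteq> snd C"
    using is_Z_map_cod[OF g] is_Z_map_cod[OF f] by (auto simp: compose_eq)
  ultimately show ?thesis using f g by (simp add: is_Z_map_def compose_extensional)
qed

theorem category_PZ: "category PZ"
proof
  show "src PZ f \<in> Ob PZ" "tgt PZ f \<in> Ob PZ" if "f \<in> Ar PZ" for f
    using that by (cases f; simp add: PZ_arrows_iff is_Z_map_def)+
  show "idn PZ X \<in> hom_set PZ X X" if "X \<in> Ob PZ" for X
    using that is_Z_map_id by (simp add: hom_set_PZ)
  show "cmp PZ g f \<in> hom_set PZ X Z" if fg: "f \<in> hom_set PZ X Y" "g \<in> hom_set PZ Y Z" for f g X Y Z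
  proof -
    obtain \<eta> where f: "f = (X, \<eta>, Y)" "is_Z_map X Y \<eta>" using fg(1) by (rule hom_set_PZE)
    obtain \<theta> where "g = (Y, \<theta>, Z)" "is_Z_map Y Z \<theta>" using fg(2) by (rule hom_set_PZE)
    then show ?thesis using f is_Z_map_compose by (simp add: hom_set_PZ)
  qed
  show "cmp PZ f (idn PZ X) = f" if "f \<in> hom_set PZ X Y" for f X Y
    using that
    by (rule hom_set_PZE) (auto simp: is_Z_map_def compose_def extensional_def restrict_def fun_eq_iff)
  show "cmp PZ (idn PZ Y) f = f" if "f \<in> hom_set PZ X Y" for f X Y
    using that
    by (rule hom_set_PZE) (auto simp: is_Z_map_def compose_def extensional_def restrict_def fun_eq_iff)
  show "cmp PZ h (cmp PZ g f) = cmp PZ (cmp PZ h g) f"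
    if fgh: "f \<in> hom_set PZ W X" "g \<in> hom_set PZ X Y" "h \<in> hom_set PZ Y Z" for f g h W X Y Z
  proof -
    obtain \<eta> where f: "f = (W, \<eta>, X)" "is_Z_map W X \<eta>" using fgh(1) by (rule hom_set_PZE)
    obtain \<theta> where g: "g = (X, \<theta>, Y)" using fgh(2) by (rule hom_set_PZE)
    obtain \<zeta> where h: "h = (Y, \<zeta>, Z)" using fgh(3) by (rule hom_set_PZE)
    have "\<eta> \<in> snd W \<rightarrow> snd X" using f(2) by (auto simp: is_Z_map_def)
    then show ?thesis using compose_assoc[of \<eta> "snd W" "snd X" \<zeta> \<theta>] by (simp add: f g h)
  qed
qed

section \<open>Limits of finite diagrams\<close>

locale finite_diagram =
  fixes J :: "('j, 'f) cat" and Fo :: "'j \<Rightarrow> pobj" and Fa :: "'f \<Rightarrow> parr"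
  assumes finite_J: "finite_category J" and diagram: "is_functor J PZ Fo Fa"
begin

abbreviation dim_at :: "'j \<Rightarrow> nat" where "dim_at j \<equiv> fst (Fo j)"
abbreviation set_at :: "'j \<Rightarrow> pt set" where "set_at j \<equiv> snd (Fo j)"
abbreviation map_at :: "'f \<Rightarrow> pt \<Rightarrow> pt" where "map_at f \<equiv> fst (snd (Fa f))"

lemma finite_Ob: "finite (Ob J)" and finite_Ar: "finite (Ar J)" and category_J: "category J"
  using finite_J by (simp_all add: finite_category_def)

lemma src_in: "f \<in> Ar J \<Longrightarrow> src J f \<in> Ob J" and tgt_in: "f \<in> Ar J \<Longrightarrow> tgt J f \<in> Ob J"
  using category_J category.src_Ob category.tgt_Ob by metis+

lemma Fo_object: "j \<in> Ob J \<Longrightarrow> Fo j \<in> PZ_objects"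
  using diagram by (simp add: is_functor_def)

lemma set_at_subset_Rn: "j \<in> Ob J \<Longrightarrow> set_at j \<subseteq> Rn (dim_at j)"
  using PZ_object_subset_Rn Fo_object by blast

lemma Fa_arrow:
  assumes "f \<in> Ar J"
  shows "Fa f = (Fo (src J f), map_at f, Fo (tgt J f))" "is_Z_map (Fo (src J f)) (Fo (tgt J f)) (map_at f)"
proof -
  have "Fa f \<in> hom_set PZ (Fo (src J f)) (Fo (tgt J f))"
    using diagram assms by (simp add: is_functor_def)
  then obtain \<eta> where "Fa f = (Fo (src J f), \<eta>, Fo (tgt J f))" "is_Z_map (Fo (src J f)) (Fo (tgt J f)) \<eta>"
    by (rule hom_set_PZE)
  then show "Fa f = (Fo (src J f), map_at f, Fo (tgt J f))"
    "is_Z_map (Fo (src J f)) (Fo (tgt J f)) (map_at f)" by simp_all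
qed

text \<open>The coordinates of \<open>\<real>\<^sup>N\<close> come in \<open>num_blocks\<close> blocks of common length \<open>width\<close>, where \<open>width\<close> exceeds the
  dimension of every object of the diagram. Coordinate \<open>i\<close> of the object \<open>j\<close> is coordinate
  \<open>index j * width + i\<close> of \<open>\<real>\<^sup>N\<close>. The remaining coordinates will be kept at zero. The successor in \<open>N\<close>
  makes the dimension positive also for the empty diagram, whose limit is the point \<open>0\<close> of \<open>\<real>\<^sup>1\<close>.\<close>

definition num_blocks :: nat where "num_blocks = card (Ob J)"
definition enum :: "nat \<Rightarrow> 'j" where "enum = (SOME h. bij_betw h {0..<num_blocks} (Ob J))"
definition index :: "'j \<Rightarrow> nat" where "index = inv_into {0..<num_blocks} enum"
definition width :: nat where "width = Suc (\<Sum>j\<in>Ob J. dim_at j)"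
definition N :: nat where "N = Suc (num_blocks * width)"

lemma bij_enum: "bij_betw enum {0..<num_blocks} (Ob J)"
  unfolding enum_def num_blocks_def using someI_ex[OF ex_bij_betw_nat_finite[OF finite_Ob]] .

lemma enum_in: "p < num_blocks \<Longrightarrow> enum p \<in> Ob J"
  using bij_enum by (auto simp: bij_betw_def)

lemma index_less: "j \<in> Ob J \<Longrightarrow> index j < num_blocks"
  using bij_enum inv_into_into[of j enum "{0..<num_blocks}"] by (auto simp: bij_betw_def index_def)

lemma enum_index: "j \<in> Ob J \<Longrightarrow> enum (index j) = j"
  using bij_enum f_inv_into_f[of j enum "{0..<num_blocks}"] by (auto simp: bij_betw_def index_def)

lemma dim_less: "j \<in> Ob J \<Longrightarrow> dim_at j < width"
  using member_le_sum[of j "Ob J" dim_at] finite_Ob by (simp add: width_def)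

lemma index_bound:
  assumes "j \<in> Ob J" "i < dim_at j"
  shows "index j * width + i < N"
proof -
  have "index j * width + i < index j * width + width" using dim_less[OF assms(1)] assms(2) by simp
  also have "\<dots> = Suc (index j) * width" by simp
  also have "\<dots> \<le> num_blocks * width" using index_less[OF assms(1)] by (intro mult_le_mono1) simp
  finally show ?thesis by (simp add: N_def)
qed

definition block :: "'j \<Rightarrow> pt \<Rightarrow> pt" where
  "block j x = pt_of (dim_at j) (\<lambda>i. coord x (index j * width + i))"

definition used :: "nat \<Rightarrow> bool" where
  "used p \<longleftrightarrow> p div width < num_blocks \<and> p mod width < dim_at (enum (p div width))"

definition glue :: "('j \<Rightarrow> pt) \<Rightarrow> pt" where
  "glue w = pt_of N (\<lambda>p. if used p then coord (w (enum (p div width))) (p mod width) else 0)"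

lemma block_in_Rn: "block j x \<in> Rn (dim_at j)" by (simp add: block_def)
lemma glue_in_Rn: "glue w \<in> Rn N" by (simp add: glue_def)

lemma glue_cong: "(\<And>j. j \<in> Ob J \<Longrightarrow> w j = w' j) \<Longrightarrow> glue w = glue w'"
  using enum_in by (auto simp: glue_def used_def intro!: arg_cong[where f = "pt_of N"])

lemma block_glue:
  assumes j: "j \<in> Ob J" and w: "w j \<in> Rn (dim_at j)"
  shows "block j (glue w) = w j"
proof (rule Rn_eqI[OF block_in_Rn w])
  fix i assume i: "i < dim_at j"
  have "i < width" using dim_less[OF j] i by simp
  then have p: "(index j * width + i) div width = index j" "(index j * width + i) mod width = i" by simp_all
  have "used (index j * width + i)" using i unfolding used_def p by (simp add: index_less[OF j] enum_index[OF j])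
  then show "coord (block j (glue w)) i = coord (w j) i"
    using i index_bound[OF j i] unfolding block_def glue_def coord_pt_of p by (simp add: enum_index[OF j])
qed

lemma block_affine:
  assumes "j \<in> Ob J" "i < dim_at j"
  shows "(\<lambda>x. coord (block j x) i) \<in> affine_form \<int> N"
  using affine_form_coord[OF subring_Ints index_bound[OF assms]] assms by (simp add: block_def)

lemma glue_block_affine:
  "(\<lambda>x. coord (glue (\<lambda>j. block j x)) p) \<in> affine_form \<int> N"
proof (cases "p < N \<and> used p")
  case True
  then show ?thesis
    using block_affine[of "enum (p div width)" "p mod width"] enum_in by (simp add: glue_def used_def)
next
  case False
  then have "coord (glue (\<lambda>j. block j x)) p = 0" for x by (auto simp: glue_def)
  then show ?thesis using affine_form_const[OF subring_Ints, of 0 N] by simp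
qed

text \<open>The first condition says that the unused coordinates are zero: \<open>glue\<close> and \<open>block\<close> restore all
  others. It makes a point of the limit determined by its blocks.\<close>

definition limit_set :: "pt set" where
  "limit_set = {x \<in> Rn N. (\<forall>p\<in>{..<N}. coord x p = coord (glue (\<lambda>j. block j x)) p) \<and>
     (\<forall>j\<in>Ob J. block j x \<in> set_at j) \<and>
     (\<forall>f\<in>Ar J. block (src J f) x \<in> set_at (src J f) \<and> map_at f (block (src J f) x) = block (tgt J f) x)}"

definition limit_object :: pobj where "limit_object = (N, limit_set)"

lemma polyhedral_block:
  assumes "j \<in> Ob J" shows "polyhedral N {x \<in> Rn N. block j x \<in> set_at j}"
  by (rule polyhedral_preimage)
    (use Fo_object[OF assms] block_affine[OF assms] in \<open>auto simp: PZ_objects_iff block_in_Rn intro: affine_form_Ints_Rats\<close>)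

text \<open>For each coordinate, compatibility along \<open>f\<close> equates a piecewise integral affine function on the
  polyhedral set \<open>Q\<close> with an integral affine one.\<close>

lemma polyhedral_commuting:
  assumes f: "f \<in> Ar J"
  shows "polyhedral N {x \<in> Rn N. block (src J f) x \<in> set_at (src J f) \<and> map_at f (block (src J f) x) = block (tgt J f) x}"
proof -
  define s t where "s = src J f" and "t = tgt J f"
  have st: "s \<in> Ob J" "t \<in> Ob J" using src_in[OF f] tgt_in[OF f] by (simp_all add: s_def t_def)
  have Z: "is_Z_map (Fo s) (Fo t) (map_at f)" using Fa_arrow(2)[OF f] by (simp add: s_def t_def)
  define Q where "Q = {x \<in> Rn N. block s x \<in> set_at s}"
  have Q: "polyhedral N Q" unfolding Q_def by (rule polyhedral_block[OF st(1)])
  have pw: "piecewise_Z_affine N Q (\<lambda>x. coord (map_at f (block s x)) i)" if i: "i < dim_at t" for i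
  proof (rule piecewise_Z_affine_compose[of "dim_at s" "set_at s" "\<lambda>y. coord (map_at f y) i" N Q "block s"])
    show "piecewise_Z_affine (dim_at s) (set_at s) (\<lambda>y. coord (map_at f y) i)"
      using Z i by (simp add: is_Z_map_def)
    show "piecewise_Z_affine N Q (\<lambda>x. coord (block s x) i')" if "i' < dim_at s" for i'
      by (rule piecewise_Z_affineI_affine[OF Q]) (use block_affine[OF st(1) that] in \<open>auto simp: Z_affine_on_def\<close>)
  qed (use Q in \<open>auto simp: Q_def\<close>)
  have "{x \<in> Rn N. block s x \<in> set_at s \<and> map_at f (block s x) = block t x}
      = Q \<inter> {x \<in> Rn N. \<forall>i\<in>{..<dim_at t}. x \<in> Q \<and> coord (map_at f (block s x)) i = coord (block t x) i}"
  proof -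
    have "map_at f (block s x) = block t x"
      if "x \<in> Q" "\<forall>i\<in>{..<dim_at t}. coord (map_at f (block s x)) i = coord (block t x) i" for x
    proof (rule Rn_eqI[OF _ block_in_Rn])
      have "block s x \<in> set_at s" using that by (simp add: Q_def)
      then show "map_at f (block s x) \<in> Rn (dim_at t)"
        using is_Z_map_cod[OF Z] set_at_subset_Rn[OF st(2)] by blast
    qed (use that(2) in simp)
    then show ?thesis by (auto simp: Q_def)
  qed
  moreover have "polyhedral N {x \<in> Rn N. x \<in> Q \<and> coord (map_at f (block s x)) i = coord (block t x) i}"
    if i: "i < dim_at t" for i
  proof -
    have "{x \<in> Rn N. x \<in> Q \<and> coord (map_at f (block s x)) i = coord (block t x) i}
       = {x \<in> Q. coord (map_at f (block s x)) i = coord (block t x) i}" by (auto simp: Q_def)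
    then show ?thesis using polyhedral_equalizer[OF pw[OF i] block_affine[OF st(2) i]] by simp
  qed
  ultimately show ?thesis
    using polyhedral_Int[OF Q polyhedral_INT[OF finite_lessThan]] unfolding s_def t_def by simp
qed

lemma limit_set_polyhedral: "polyhedral N limit_set"
proof -
  have A: "polyhedral N {x \<in> Rn N. \<forall>p\<in>{..<N}. coord x p = coord (glue (\<lambda>j. block j x)) p}"
  proof (rule polyhedral_INT[OF finite_lessThan])
    fix p assume "p \<in> {..<N}"
    then show "polyhedral N {x \<in> Rn N. coord x p = coord (glue (\<lambda>j. block j x)) p}"
      by (intro h_polyhedron_imp_polyhedral h_polyhedron_equation affine_form_coord subring_Rats
          affine_form_Ints_Rats[OF glue_block_affine]) simp
  qed
  have B: "polyhedral N {x \<in> Rn N. \<forall>j\<in>Ob J. block j x \<in> set_at j}"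
    by (rule polyhedral_INT[OF finite_Ob polyhedral_block])
  have C: "polyhedral N {x \<in> Rn N. \<forall>f\<in>Ar J. block (src J f) x \<in> set_at (src J f) \<and>
      map_at f (block (src J f) x) = block (tgt J f) x}"
    by (rule polyhedral_INT[OF finite_Ar polyhedral_commuting])
  have "limit_set = {x \<in> Rn N. \<forall>p\<in>{..<N}. coord x p = coord (glue (\<lambda>j. block j x)) p} \<inter>
    ({x \<in> Rn N. \<forall>j\<in>Ob J. block j x \<in> set_at j} \<inter>
     {x \<in> Rn N. \<forall>f\<in>Ar J. block (src J f) x \<in> set_at (src J f) \<and>
      map_at f (block (src J f) x) = block (tgt J f) x})"
    by (auto simp: limit_set_def)
  then show ?thesis using polyhedral_Int[OF A polyhedral_Int[OF B C]] by simp
qed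

lemma glue_block:
  assumes "x \<in> limit_set" shows "glue (\<lambda>j. block j x) = x"
  by (rule Rn_eqI[of _ N]) (use assms in \<open>auto simp: limit_set_def glue_in_Rn\<close>)

lemma limit_set_bounded: "coord_bounded limit_set"
proof -
  have "coord_bounded (\<Union>(set_at ` Ob J))"
    by (rule coord_bounded_Union) (use finite_Ob Fo_object in \<open>auto simp: PZ_objects_iff\<close>)
  then obtain B where B: "\<forall>x\<in>\<Union>(set_at ` Ob J). \<forall>i. \<bar>coord x i\<bar> \<le> B" by (rule coord_boundedE)
  have "\<bar>coord x p\<bar> \<le> \<bar>B\<bar>" if x: "x \<in> limit_set" for x p
  proof (cases "p < N \<and> used p")
    case True
    define j where "j = enum (p div width)"
    have j: "j \<in> Ob J" using True enum_in by (simp add: j_def used_def)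
    have "coord x p = coord (glue (\<lambda>j. block j x)) p" by (simp add: glue_block[OF x])
    also have "\<dots> = coord (block j x) (p mod width)" using True by (simp add: glue_def j_def)
    finally have "coord x p = coord (block j x) (p mod width)" .
    moreover have "block j x \<in> set_at j" using x j by (simp add: limit_set_def)
    ultimately have "\<bar>coord x p\<bar> \<le> B" using B j by auto
    then show ?thesis by simp
  next
    case False
    have "coord x p = coord (glue (\<lambda>j. block j x)) p" by (simp add: glue_block[OF x])
    then show ?thesis using False by (auto simp: glue_def)
  qed
  then have "\<forall>x\<in>limit_set. \<forall>i. \<bar>coord x i\<bar> \<le> \<bar>B\<bar>" by simp
  then show ?thesis unfolding coord_bounded_def by (rule exI)
qed

lemma limit_object_in_PZ: "limit_object \<in> PZ_objects"
proof -
  have "1 \<le> N" by (simp add: N_def)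
  then show ?thesis by (simp add: limit_object_def PZ_objects_iff limit_set_polyhedral limit_set_bounded)
qed

definition proj :: "'j \<Rightarrow> parr" where
  "proj j = (limit_object, restrict (block j) limit_set, Fo j)"

lemma proj_hom: "j \<in> Ob J \<Longrightarrow> proj j \<in> hom_set PZ limit_object (Fo j)"
proof -
  assume j: "j \<in> Ob J"
  have "piecewise_Z_affine N limit_set (\<lambda>x. coord (restrict (block j) limit_set x) i)" if i: "i < dim_at j" for i
    by (rule piecewise_Z_affineI_affine[OF limit_set_polyhedral], unfold Z_affine_on_def,
        rule bexI[OF _ block_affine[OF j i]]) simp
  then have "is_Z_map limit_object (Fo j) (restrict (block j) limit_set)"
    using limit_object_in_PZ Fo_object[OF j] j unfolding is_Z_map_def
    by (auto simp: limit_object_def) (auto simp: limit_set_def)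
  then show ?thesis by (simp add: hom_set_PZ proj_def)
qed

lemma proj_cone: "is_cone J PZ Fo Fa limit_object proj"
  unfolding is_cone_def
proof (intro conjI ballI)
  show "limit_object \<in> Ob PZ" by (simp add: limit_object_in_PZ)
  show "proj j \<in> hom_set PZ limit_object (Fo j)" if "j \<in> Ob J" for j using that by (rule proj_hom)
  fix f assume f: "f \<in> Ar J"
  have "compose limit_set (map_at f) (restrict (block (src J f)) limit_set) = restrict (block (tgt J f)) limit_set"
  proof
    fix x
    show "compose limit_set (map_at f) (restrict (block (src J f)) limit_set) x = restrict (block (tgt J f)) limit_set x"
      using f by (cases "x \<in> limit_set") (simp_all add: compose_def, simp add: limit_set_def)
  qed
  then show "cmp PZ (Fa f) (proj (src J f)) = proj (tgt J f)"
    by (subst Fa_arrow(1)[OF f]) (simp add: proj_def limit_object_def)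
qed

text \<open>The mediating map glues the components of the cone. Its coordinates are coordinates of these
  components or zero, so it is piecewise integral affine. It is unique since \<open>glue_block\<close> recovers
  a point of the limit from its blocks.\<close>

lemma cone_factors_uniquely:
  assumes cone: "is_cone J PZ Fo Fa Y \<mu>"
  shows "\<exists>!u. u \<in> hom_set PZ Y limit_object \<and> (\<forall>j\<in>Ob J. cmp PZ (proj j) u = \<mu> j)"
proof -
  define m where "m j = fst (snd (\<mu> j))" for j
  have Y: "Y \<in> PZ_objects" using cone by (simp add: is_cone_def)
  have mu: "\<mu> j = (Y, m j, Fo j)" "is_Z_map Y (Fo j) (m j)" if "j \<in> Ob J" for j
  proof -
    have "\<mu> j \<in> hom_set PZ Y (Fo j)" using cone that by (simp add: is_cone_def)
    then obtain \<eta> where "\<mu> j = (Y, \<eta>, Fo j)" "is_Z_map Y (Fo j) \<eta>" by (rule hom_set_PZE)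
    then show "\<mu> j = (Y, m j, Fo j)" "is_Z_map Y (Fo j) (m j)" by (simp_all add: m_def)
  qed
  have m_in: "m j y \<in> set_at j" if "j \<in> Ob J" "y \<in> snd Y" for j y
    using is_Z_map_cod[OF mu(2)[OF that(1)] that(2)] .
  have m_comm: "map_at f (m (src J f) y) = m (tgt J f) y" if f: "f \<in> Ar J" and y: "y \<in> snd Y" for f y
  proof -
    have "cmp PZ (Fa f) (\<mu> (src J f)) = \<mu> (tgt J f)" using cone f by (simp add: is_cone_def)
    moreover have "cmp PZ (Fa f) (\<mu> (src J f)) = (Y, compose (snd Y) (map_at f) (m (src J f)), Fo (tgt J f))"
      by (subst Fa_arrow(1)[OF f]) (simp add: mu(1)[OF src_in[OF f]])
    ultimately have "compose (snd Y) (map_at f) (m (src J f)) = m (tgt J f)"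
      using mu(1)[OF tgt_in[OF f]] by simp
    then show ?thesis using y by (metis compose_eq)
  qed
  define v where "v = restrict (\<lambda>y. glue (\<lambda>j. m j y)) (snd Y)"
  have block_v: "block j (v y) = m j y" if "j \<in> Ob J" "y \<in> snd Y" for j y
    using block_glue[OF that(1), of "\<lambda>j. m j y"] m_in[OF that] set_at_subset_Rn[OF that(1)] that(2)
    by (auto simp: v_def)
  have v_in: "v y \<in> limit_set" if y: "y \<in> snd Y" for y
  proof -
    have "glue (\<lambda>j. block j (v y)) = glue (\<lambda>j. m j y)"
      by (rule glue_cong) (rule block_v[OF _ y])
    then have "glue (\<lambda>j. block j (v y)) = v y" using y by (simp add: v_def)
    moreover have "v y \<in> Rn N" using y by (simp add: v_def glue_in_Rn)
    ultimately show ?thesis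
      using block_v[OF _ y] m_in[OF _ y] m_comm[OF _ y] src_in tgt_in by (simp add: limit_set_def)
  qed
  have v_pw: "piecewise_Z_affine (fst Y) (snd Y) (\<lambda>y. coord (v y) p)" for p
  proof (cases "p < N \<and> used p")
    case True
    define j where "j = enum (p div width)"
    have j: "j \<in> Ob J" "p mod width < dim_at j" using True enum_in by (simp_all add: j_def used_def)
    have "piecewise_Z_affine (fst Y) (snd Y) (\<lambda>y. coord (m j y) (p mod width))"
      using mu(2)[OF j(1)] j(2) by (simp add: is_Z_map_def)
    then show ?thesis
      by (rule piecewise_Z_affine_cong) (use True in \<open>simp add: v_def glue_def j_def\<close>)
  next
    case False
    have "\<forall>y\<in>snd Y. coord (v y) p = 0" using False by (auto simp: v_def glue_def)
    then have "Z_affine_on (fst Y) (snd Y) (\<lambda>y. coord (v y) p)"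
      unfolding Z_affine_on_def
      by (rule bexI[of _ "\<lambda>x. 0"]) (rule affine_form_const[OF subring_Ints], simp)
    then show ?thesis using piecewise_Z_affineI_affine Y by (simp add: PZ_objects_iff)
  qed
  have v_Z: "is_Z_map Y limit_object v"
    unfolding is_Z_map_def using Y limit_object_in_PZ v_in v_pw by (auto simp: limit_object_def v_def)
  show ?thesis
  proof (rule ex1I[of _ "(Y, v, limit_object)"])
    have "cmp PZ (proj j) (Y, v, limit_object) = \<mu> j" if j: "j \<in> Ob J" for j
    proof -
      have "compose (snd Y) (restrict (block j) limit_set) v = m j"
      proof
        fix y
        have "m j \<in> extensional (snd Y)" using mu(2)[OF j] by (simp add: is_Z_map_def)
        then show "compose (snd Y) (restrict (block j) limit_set) v y = m j y"
          using v_in block_v[OF j] by (cases "y \<in> snd Y") (simp_all add: compose_def extensional_def)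
      qed
      then show ?thesis by (simp add: proj_def mu(1)[OF j])
    qed
    then show "(Y, v, limit_object) \<in> hom_set PZ Y limit_object \<and> (\<forall>j\<in>Ob J. cmp PZ (proj j) (Y, v, limit_object) = \<mu> j)"
      using v_Z by (simp add: hom_set_PZ)
  next
    fix u assume u: "u \<in> hom_set PZ Y limit_object \<and> (\<forall>j\<in>Ob J. cmp PZ (proj j) u = \<mu> j)"
    then obtain v' where v': "u = (Y, v', limit_object)" "is_Z_map Y limit_object v'"
      using hom_set_PZE by blast
    have "v' y = v y" for y
    proof (cases "y \<in> snd Y")
      case True
      have in_lim: "v' y \<in> limit_set" using is_Z_map_cod[OF v'(2) True] by (simp add: limit_object_def)
      have "block j (v' y) = m j y" if j: "j \<in> Ob J" for j
      proof -
        have "cmp PZ (proj j) u = \<mu> j" using u j by blast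
        then have "compose (snd Y) (restrict (block j) limit_set) v' = m j"
          by (simp add: v'(1) proj_def mu(1)[OF j])
        then have "m j y = restrict (block j) limit_set (v' y)" using True by (metis compose_eq)
        then show ?thesis using in_lim by simp
      qed
      then have "glue (\<lambda>j. block j (v' y)) = glue (\<lambda>j. m j y)" by (rule glue_cong)
      then show ?thesis using glue_block[OF in_lim] True by (simp add: v_def)
    next
      case False
      then show ?thesis using v'(2) by (simp add: is_Z_map_def extensional_def v_def)
    qed
    then show "u = (Y, v, limit_object)" by (simp add: v'(1) fun_eq_iff)
  qed
qed

theorem limit_is_limit: "is_limit J PZ Fo Fa limit_object proj"
  unfolding is_limit_def using proj_cone cone_factors_uniquely by blast

end

theorem theorem3p1:
  shows "category PZ \<and>
    (\<forall>(J :: ('j, 'f) cat) Fo Fa.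
       finite_category J \<and> is_functor J PZ Fo Fa \<longrightarrow>
       (\<exists>L \<pi>. is_limit J PZ Fo Fa L \<pi>))"
proof (intro conjI allI impI)
  show "category PZ" by (rule category_PZ)
  fix J :: "('j, 'f) cat" and Fo Fa
  assume "finite_category J \<and> is_functor J PZ Fo Fa"
  then interpret finite_diagram J Fo Fa by unfold_locales simp_all
  show "\<exists>L \<pi>. is_limit J PZ Fo Fa L \<pi>" using limit_is_limit by (intro exI)
qed

end
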